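(* Let $m\geq 1$ and $n\geq 1$ be integers. Then: 1. The quantized Donaldson-Thomas invariant $\mathrm{DT}_n^{(m)}(q)$ is given by $$\mathrm{DT}_n^{(m)}(q)=q^{1-n}\,\frac{1}{[n]}\sum_{C\in U_n^{\mathrm{prim},+}/C_n}q^{\mathrm{wt}(C)},\qquad [n]=1+q+\ldots+q^{n-1},$$ and it is a polynomial in $q$ with integer coefficients. 2. For any $i\in\{0,\ldots,n-1\}$, the (unquantized) Donaldson-Thomas invariant $\mathrm{DT}_n^{(m)}$ equals the number of classes $C\in U_n^{\mathrm{prim},+}/C_n$ of weight $\mathrm{wt}(C)\equiv i\bmod n$.
   Context: Fix an integer $m\ge 1$. Quantized invariants. Let $H(q,t)=\sum_{n\geq 0}\frac{q^{(m-1)\binom{n}{2}}}{(1-q^{-1})\cdots(1-q^{-n})}t^n\in\mathbf{Q}(q)[[t]]$. For $f(q,t)\in\mathbf{Q}(q)[[t]]$ without constant term in $t$, the $\lambda$-ring exponential is $\mathrm{Exp}(f)=\exp\left(\sum_{i\geq 1}\frac1i f(q^i,t^i)\right)$; it is a bijection onto the series with constant term $1$. The elements $\mathrm{DT}_n^{(m)}(q)\in\mathbf{Q}(q)$, $n\ge1$, are uniquely defined by $$H(q,(-1)^{m-1}t)=\mathrm{Exp}\left(\frac{1}{1-q^{-1}}\sum_{n\geq 1}\mathrm{DT}_n^{(m)}(q)\,((-1)^{m-1}t)^n\right),$$ where in applying $\mathrm{Exp}$ the signs $(-1)^{(m-1)n}$ are treated as integer coefficients. Unquantized invariants. Let $F(t)\in\mathbf{Z}[[t]]$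 be the unique power series with $F(t)=1+tF(t)^m$ (the generating series $\sum_n\chi(\mathrm{Hilb}_n^{(m)})t^n$ of Euler characteristics of the noncommutative Hilbert schemes of the free algebra in $m$ variables, where $\mathrm{Hilb}_n^{(m)}$ parametrizes left ideals of codimension $n$). The numbers $\mathrm{DT}_n^{(m)}\in\mathbf{Q}$, $n\geq 1$, are uniquely defined by $F((-1)^{m-1}t)=\prod_{n\geq 1}(1-t^n)^{-(-1)^{(m-1)n}\,n\,\mathrm{DT}_n^{(m)}}$. Sequences. $U_n$ is the set of sequences $(a_1,\ldots,a_n)$ of nonnegative integers with $a_1+\ldots+a_n=(m-1)n$. The cyclic group $C_n$ of order $n$ acts on $U_n$ by cyclic shifts. A sequence is primitive if it is different from all its proper cyclic shifts; $U_n^{\mathrm{prim}}\subset U_n$ is the subset of primitive sequences. For $d\mid n$, $U_n^{d-\mathrm{prim}}\subset U_n$ is the set of sequences which are the $(n/d)$-fold repetition of a primitive sequence in $U_d$. Set $U_n^{\mathrm{prim},+}=U_n^{\mathrm{prim}}\cup U_n^{\overline n-\mathrm{prim}}$ if $m$ is even and $n=2\overline n\equiv 2\bmod 4$, and $U_n^{\mathrm{prim},+}=U_n^{\mathrm{prim}}$ otherwise. $U_n^{\mathrm{prim},+}/C_n$ is the set of $C_n$-orbits. The weight is $\mathrm{wt}(a_1,\ldots,a_n)=\sum_{i=1}^n(n-i)(m-1-a_i)$, and for an orbit $C$, $\mathrm{wt}(C)$ is the maximum of $\mathrm{wt}(a)$ over $a\in C$.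
   Formalization: The prefactor q^{1-n} in part 1 is corrected to q^{n-1}: for m = n = 2 the definitions give DT_2(q) = q, whereas the printed formula gives q^{-1}, which is not a polynomial; all else is as stated. *)

theory Defs
  imports "HOL-Computational_Algebra.Computational_Algebra" "HOL-Number_Theory.Cong"
begin

section \<open>Quantized invariants\<close>

type_synonym ratfun = "rat poly fract"

definition embed_poly :: "rat poly \<Rightarrow> ratfun" where
  "embed_poly p = Fraction_Field.Fract p 1"

definition qvar :: ratfun where
  "qvar = embed_poly (monom 1 1)"

text \<open>
  \<open>f(q) \<mapsto> f(q\<^sup>i)\<close>, well defined for \<open>i \<ge> 1\<close> because then \<open>b(q\<^sup>i) \<noteq> 0\<close> whenever \<open>b \<noteq> 0\<close>.
\<close>

definition subst_qpow :: "nat \<Rightarrow> ratfun \<Rightarrow> ratfun" where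
  "subst_qpow i x = (THE y. \<exists>a b. b \<noteq> 0 \<and> x = Fraction_Field.Fract a b \<and>
     y = Fraction_Field.Fract (a \<circ>\<^sub>p monom 1 i) (b \<circ>\<^sub>p monom 1 i))"

text \<open>
  The substitution \<open>f(q, t) \<mapsto> f(q\<^sup>i, t\<^sup>i)\<close>, for \<open>i \<ge> 1\<close>. It fixes rational constants, so signs occurring
  as coefficients of \<open>f\<close> are left unchanged.
\<close>

definition adams :: "nat \<Rightarrow> ratfun fps \<Rightarrow> ratfun fps" where
  "adams i f = Abs_fps (\<lambda>n. if i dvd n then subst_qpow i (f $ (n div i)) else 0)"

text \<open>The infinite sum is a limit in the \<open>t\<close>-adic metric of the type \<open>fps\<close>.\<close>

definition plethystic_exp :: "ratfun fps \<Rightarrow> ratfun fps" where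
  "plethystic_exp f =
     fps_exp 1 oo (\<Sum>i. fps_const (1 / of_nat (Suc i)) * adams (Suc i) f)"

definition H_series :: "nat \<Rightarrow> ratfun fps" where
  "H_series m = Abs_fps (\<lambda>n. qvar ^ ((m - 1) * (n choose 2)) / (\<Prod>k=1..n. 1 - qvar powi (- int k)))"

definition sign_t :: "nat \<Rightarrow> 'a :: comm_ring_1 fps" where
  "sign_t m = fps_const ((-1) ^ (m - 1)) * fps_X"

definition quantized_DT_series :: "nat \<Rightarrow> ratfun fps" where
  "quantized_DT_series m = (THE D. D $ 0 = 0 \<and>
     H_series m oo sign_t m
       = plethystic_exp (fps_const (1 / (1 - qvar powi (- 1))) * (D oo sign_t m)))"

definition quantized_DT :: "nat \<Rightarrow> nat \<Rightarrow> ratfun" where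
  "quantized_DT m n = quantized_DT_series m $ n"

definition qint :: "nat \<Rightarrow> ratfun" where
  "qint n = (\<Sum>i<n. qvar ^ i)"

section \<open>Unquantized invariants\<close>

definition F_series :: "nat \<Rightarrow> int fps" where
  "F_series m = (THE F. F = 1 + fps_X * F ^ m)"

text \<open>\<open>(1 - t\<^sup>n)\<^sup>c\<close> for a rational exponent \<open>c\<close>, by the binomial series.\<close>

definition one_minus_tpow :: "nat \<Rightarrow> rat \<Rightarrow> rat fps" where
  "one_minus_tpow n c = fps_binomial c oo (- (fps_X ^ n))"

text \<open>
  The invariants are indexed by \<open>n \<ge> 1\<close>; the value at \<open>0\<close> is pinned only to make the sequence unique.
  The infinite product is the \<open>t\<close>-adic limit of its partial products.
\<close>

definition DT_seq :: "nat \<Rightarrow> nat \<Rightarrow> rat" where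
  "DT_seq m = (THE d. d 0 = 0 \<and>
     (\<lambda>N. \<Prod>n=1..N. one_minus_tpow n (- ((-1) ^ ((m - 1) * n) * of_nat n * d n)))
       \<longlonglongrightarrow> (Abs_fps (\<lambda>k. of_int (F_series m $ k)) oo sign_t m))"

definition DT :: "nat \<Rightarrow> nat \<Rightarrow> rat" where
  "DT m n = DT_seq m n"

section \<open>Cyclic classes of sequences\<close>

definition U :: "nat \<Rightarrow> nat \<Rightarrow> nat list set" where
  "U m n = {a. length a = n \<and> sum_list a = (m - 1) * n}"

definition primitive :: "nat list \<Rightarrow> bool" where
  "primitive a \<longleftrightarrow> (\<forall>k\<in>{1..<length a}. rotate k a \<noteq> a)"

definition U_prim :: "nat \<Rightarrow> nat \<Rightarrow> nat list set" where
  "U_prim m n = {a \<in> U m n. primitive a}"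

definition U_dprim :: "nat \<Rightarrow> nat \<Rightarrow> nat \<Rightarrow> nat list set" where
  "U_dprim m n d = {a \<in> U m n. \<exists>b \<in> U_prim m d. a = concat (replicate (n div d) b)}"

definition U_prim_plus :: "nat \<Rightarrow> nat \<Rightarrow> nat list set" where
  "U_prim_plus m n =
     (if even m \<and> n mod 4 = 2 then U_prim m n \<union> U_dprim m n (n div 2) else U_prim m n)"

definition cyclic_class :: "nat list \<Rightarrow> nat list set" where
  "cyclic_class a = range (\<lambda>k. rotate k a)"

definition U_prim_plus_classes :: "nat \<Rightarrow> nat \<Rightarrow> nat list set set" where
  "U_prim_plus_classes m n = cyclic_class ` U_prim_plus m n"

text \<open>List entries are counted from \<open>0\<close>, so the \<open>i\<close>-th term of the sequence is \<open>a ! (i - 1)\<close>.\<close>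

definition wt :: "nat \<Rightarrow> nat list \<Rightarrow> int" where
  "wt m a = (\<Sum>i=1..length a. (int (length a) - int i) * (int m - 1 - int (a ! (i - 1))))"

definition class_wt :: "nat \<Rightarrow> nat list set \<Rightarrow> int" where
  "class_wt m C = Max (wt m ` C)"

text \<open>
  Pitfall: the factor relating the class sum to \<open>quantized_DT m n\<close> is
  \<open>q^(n-1) / [n] = 1 / (q^(1-n) [n]) = (1 - q^(-1)) / (1 - q^(-n))\<close>, the inverse of the quantum
  integer in \<open>q^(-1)\<close>. In the literature it is printed as \<open>q^(1-n) / [n]\<close>, which is a misprint: for
  \<open>m = n = 2\<close> the class weights are \<open>0\<close> and \<open>1\<close>, so that formula would give \<open>q^(-1)\<close>, not a polynomial,
  while comparing coefficients of \<open>t^2\<close> in the definition gives \<open>q\<close>.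
\<close>

end

theory Submission
  imports Defs
begin

text \<open>
  Write \<open>B\<^sub>N(q)\<close> for the sum of \<open>q\<close> to the class weight over all words in \<open>U\<^sub>N\<close>. Everything rests
  on the formula \<open>t H'/H = \<Sum>\<^sub>N B\<^sub>N(q) t\<^sup>N / (1 - q\<^sup>-\<^sup>N)\<close>. The quotient \<open>H(q, t) / H(q, q\<^sup>-\<^sup>1 t)\<close> counts
  Dyck-like words by area, because both satisfy the same functional equation, and cutting a Dyck word
  with a marked step at its next return to \<open>0\<close> shows that the logarithmic derivative of the counting
  series is \<open>\<Sum>\<^sub>N B\<^sub>N(q) t\<^sup>N\<close>. At \<open>q = 1\<close> the counting series is \<open>F\<close>.

  Every word is a power of a primitive one, so \<open>B\<^sub>N(q)\<close> is the sum over \<open>n\<close> dividing \<open>N\<close> of \<open>n\<close> times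
  the primitive class sum of length \<open>n\<close> at \<open>q\<^sup>N\<^sup>/\<^sup>n\<close>. Up to the signs this is the logarithmic derivative
  of a plethystic exponential and, at \<open>q = 1\<close>, of the product defining the unquantized invariants.

  At an \<open>N\<close>-th root of unity of order \<open>d\<close>, \<open>B\<^sub>N\<close> takes up to sign the value of \<open>B\<close> of index \<open>N / d\<close> at
  \<open>1\<close>. Inverting the divisor sum, the class sum of length \<open>n\<close> vanishes at all nontrivial \<open>n\<close>-th roots of
  unity. Hence the class weights are equidistributed modulo \<open>n\<close>, which gives integrality and the
  second statement.
\<close>

section \<open>Logarithmic derivatives of power series\<close>

abbreviation dilate :: "'a::comm_ring_1 \<Rightarrow> 'a fps \<Rightarrow> 'a fps" where
  "dilate c F \<equiv> F oo (fps_const c * fps_X)"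

lemma dilate_mult: "dilate c (F * G) = dilate c F * dilate (c :: 'a::idom) G"
  by (rule fps_compose_mult_distrib) simp

text \<open>The operator \<open>t d/dt\<close> is used instead of \<open>d/dt\<close>, so that
  coefficient \<open>n\<close> stays at index \<open>n\<close>. Dilations and substitutions of
  \<open>t ^ d\<close> for \<open>t\<close> then act on the coefficients without an index
  shift.\<close>

definition log_deriv :: "'a::field fps \<Rightarrow> 'a fps" where
  "log_deriv F = fps_XD F * inverse F"

lemma XD_mult: "fps_XD (F * G) = fps_XD F * G + F * fps_XD (G :: 'a::comm_ring_1 fps)"
  by (simp add: fps_XD_def algebra_simps)

lemma log_deriv_eq_iff:
  assumes "F $ 0 \<noteq> 0"
  shows "log_deriv F = A \<longleftrightarrow> fps_XD F = F * A"
proof -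
  have *: "F * inverse F = 1"
    using assms by (simp add: inverse_mult_eq_1')
  have "fps_XD F = F * log_deriv F"
    unfolding log_deriv_def by (metis * mult.left_commute mult.right_neutral)
  moreover have "F \<noteq> 0" using assms by auto
  ultimately show ?thesis by auto
qed

lemma XD_eq_log_deriv: "F $ 0 \<noteq> 0 \<Longrightarrow> fps_XD F = F * log_deriv F"
  using log_deriv_eq_iff by blast

lemma log_deriv_nth_0 [simp]: "log_deriv F $ 0 = 0"
  by (simp add: log_deriv_def)

lemma log_deriv_mult:
  assumes "F $ 0 \<noteq> 0" "G $ 0 \<noteq> 0"
  shows "log_deriv (F * G) = log_deriv F + log_deriv G"
  using assms by (subst log_deriv_eq_iff) (auto simp: XD_mult XD_eq_log_deriv algebra_simps)

lemma log_deriv_1 [simp]: "log_deriv 1 = 0"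
  by (subst log_deriv_eq_iff) (auto simp: fps_XD_def)

lemma log_deriv_prod:
  assumes "\<And>i. i \<in> I \<Longrightarrow> f i $ 0 = 1"
  shows "log_deriv (prod f I) = (\<Sum>i\<in>I. log_deriv (f i)) \<and> prod f I $ 0 = 1"
  using assms by (induction I rule: infinite_finite_induct) (simp_all add: log_deriv_mult)

lemma log_deriv_prod_list:
  assumes "\<And>i. i \<in> set is \<Longrightarrow> f i $ 0 = 1"
  shows "log_deriv (\<Prod>i\<leftarrow>is. f i) = (\<Sum>i\<leftarrow>is. log_deriv (f i)) \<and> (\<Prod>i\<leftarrow>is. f i) $ 0 = 1"
  using assms by (induction "is") (simp_all add: log_deriv_mult)

lemma log_deriv_dilate:
  assumes "F $ 0 \<noteq> 0"
  shows "log_deriv (dilate c F) = dilate c (log_deriv F)"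
proof -
  have "fps_XD (dilate c F) = dilate c (fps_XD F)"
    by (rule fps_ext) (simp add: mult.left_commute)
  then show ?thesis
    using assms by (subst log_deriv_eq_iff) (auto simp: XD_eq_log_deriv dilate_mult)
qed

text \<open>Coefficient \<open>n\<close> of \<open>t F' = F * log_deriv F\<close>, with the end
  terms of the convolution split off. This is a Newton-type recursion that determines either series
  from the other.\<close>

lemma log_deriv_nth:
  assumes "F $ 0 = 1"
  shows "of_nat n * F $ n = log_deriv F $ n + (\<Sum>i\<in>{1..<n}. F $ i * log_deriv F $ (n - i))"
proof (cases n)
  case (Suc k)
  have "of_nat n * F $ n = (F * log_deriv F) $ n"
    using assms XD_eq_log_deriv[of F] by (metis fps_XD_nth one_neq_zero)
  also have "\<dots> = (\<Sum>i=0..n. F $ i * log_deriv F $ (n - i))"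
    by (simp add: fps_mult_nth)
  also have "{0..n} = insert 0 (insert n {1..<n})"
    using Suc by auto
  also have "(\<Sum>i\<in>\<dots>. F $ i * log_deriv F $ (n - i)) = log_deriv F $ n + (\<Sum>i\<in>{1..<n}. F $ i * log_deriv F $ (n - i))"
    using Suc assms by simp
  finally show ?thesis .
qed simp

text \<open>Characteristic 0 permits division by the index in the recursion above. The truncated
  form serves for \<open>t\<close>-adic limits, where only finitely many coefficients agree at each
  stage.\<close>

lemma log_deriv_cong_upto:
  fixes F G :: "'a::field_char_0 fps"
  assumes "F $ 0 = 1" "G $ 0 = 1"
  shows "(\<forall>k\<le>n. log_deriv F $ k = log_deriv G $ k) \<longleftrightarrow> (\<forall>k\<le>n. F $ k = G $ k)"
proof (induction n)
  case (Suc n)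
  have "log_deriv F $ Suc n = log_deriv G $ Suc n \<longleftrightarrow> F $ Suc n = G $ Suc n"
    if *: "\<forall>k\<le>n. log_deriv F $ k = log_deriv G $ k" "\<forall>k\<le>n. F $ k = G $ k"
  proof -
    have "(\<Sum>i\<in>{1..<Suc n}. F $ i * log_deriv F $ (Suc n - i)) = (\<Sum>i\<in>{1..<Suc n}. G $ i * log_deriv G $ (Suc n - i))"
      using * by (intro sum.cong) auto
    then have "of_nat (Suc n) * F $ Suc n - of_nat (Suc n) * G $ Suc n = log_deriv F $ Suc n - log_deriv G $ Suc n"
      unfolding log_deriv_nth[OF assms(1)] log_deriv_nth[OF assms(2)] by simp
    moreover have "of_nat (Suc n) * F $ Suc n - of_nat (Suc n) * G $ Suc n
        = of_nat (Suc n) * (F $ Suc n - G $ Suc n)"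
      by (simp only: right_diff_distrib)
    ultimately have "log_deriv F $ Suc n - log_deriv G $ Suc n = of_nat (Suc n) * (F $ Suc n - G $ Suc n)"
      by argo
    moreover have "of_nat (Suc n) \<noteq> (0::'a)" by (rule of_nat_neq_0)
    ultimately show ?thesis
      by (metis eq_iff_diff_eq_0 mult_eq_0_iff)
  qed
  then show ?case using Suc by (auto simp: le_Suc_eq)
qed (use assms in auto)

lemma log_deriv_inject:
  fixes F G :: "'a::field_char_0 fps"
  assumes "F $ 0 = 1" "G $ 0 = 1" "log_deriv F = log_deriv G"
  shows "F = G"
  using log_deriv_cong_upto[OF assms(1,2)] assms(3) by (auto simp: fps_eq_iff)

lemma log_deriv_exp_compose:
  fixes g :: "'a::field_char_0 fps"
  assumes "g $ 0 = 0"
  shows "log_deriv (fps_exp 1 oo g) = fps_XD g"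
  using assms by (subst log_deriv_eq_iff) (simp_all add: fps_XD_def fps_compose_deriv mult_ac)

lemma geometric_fps: "Abs_fps (\<lambda>k. x ^ k) * (1 - fps_const x * fps_X) = (1 :: 'a::comm_ring_1 fps)"
proof -
  have "(Abs_fps (\<lambda>k. x ^ k) * (1 - fps_X * fps_const x)) $ n = (1 :: 'a fps) $ n" for n
    by (cases n) (simp_all add: right_diff_distrib mult.assoc [symmetric])
  then show ?thesis by (simp add: fps_eq_iff mult.commute)
qed

text \<open>With \<open>G = 1 / (1 - x t)\<close>, differentiating \<open>G (1 - x t) = 1\<close>
  and replacing \<open>x t\<close> by \<open>1 - (1 - x t)\<close> gives
  \<open>t G' = G (G - 1)\<close>; the claimed series is \<open>G - 1\<close>.\<close>

lemma log_deriv_geometric: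
  "log_deriv (Abs_fps (\<lambda>k. x ^ k)) = Abs_fps (\<lambda>k. if k = 0 then 0 else (x :: 'a::field) ^ k)"
proof -
  define G where "G = Abs_fps (\<lambda>k. x ^ k)"
  have A: "Abs_fps (\<lambda>k. if k = 0 then 0 else x ^ k) = G - 1"
    by (auto simp: G_def fps_eq_iff)
  have B: "G * (1 - fps_const x * fps_X) = 1" 
    unfolding G_def by (rule geometric_fps)
  have "fps_XD (G * (1 - fps_const x * fps_X)) = 0"
    unfolding B by (simp add: fps_XD_def)
  moreover have "fps_XD (1 - fps_const x * fps_X) = - (fps_const x * fps_X)"
    by (simp add: fps_XD_def mult.commute)
  ultimately have "fps_XD G * (1 - fps_const x * fps_X) = G * (fps_const x * fps_X)"
    unfolding XD_mult by (simp only: mult_minus_right add_eq_0_iff minus_minus) simp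
  also have "\<dots> = (G * (G * (1 - fps_const x * fps_X))) * (fps_const x * fps_X)"
    by (simp add: B)
  also have "\<dots> = G * (G - G * (1 - fps_const x * fps_X)) * (1 - fps_const x * fps_X)"
    by (simp add: algebra_simps)
  finally have "fps_XD G * (1 - fps_const x * fps_X) = (G * (G - 1)) * (1 - fps_const x * fps_X)"
    by (simp only: B)
  moreover have "1 - fps_const x * fps_X \<noteq> 0" using B by auto
  ultimately have "fps_XD G = G * (G - 1)" by (metis mult_right_cancel)
  then have "log_deriv G = G - 1"
    by (subst log_deriv_eq_iff) (auto simp: G_def)
  then show ?thesis by (simp add: A flip: G_def)
qed

lemma one_minus_tpow_0 [simp]: "one_minus_tpow n c $ 0 = 1"
  by (simp add: one_minus_tpow_def)

text \<open>The binomial series \<open>B\<close> satisfies \<open>(1 + t) B' = c B\<close>.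
  Substituting \<open>- t ^ n\<close> gives the logarithmic derivative
  \<open>- c n t ^ n / (1 - t ^ n)\<close>, a geometric series in \<open>t ^ n\<close>.\<close>

lemma log_deriv_one_minus_tpow:
  assumes "n \<ge> 1"
  shows "log_deriv (one_minus_tpow n c) = Abs_fps (\<lambda>k. if k > 0 \<and> n dvd k then - (c * of_nat n) else 0)"
proof -
  let ?b = "- (fps_X ^ n) :: rat fps"
  let ?A = "Abs_fps (\<lambda>k. if k > 0 \<and> n dvd k then - (c * of_nat n) else 0)"
  have b0: "?b $ 0 = 0" using assms by simp
  have "(1 + fps_X) * fps_deriv (fps_binomial c) = fps_const c * fps_binomial c"
    by (simp add: fps_binomial_deriv fps_divide_unit inverse_mult_eq_1' mult_ac)
  then have "((1 + fps_X) oo ?b) * (fps_deriv (fps_binomial c) oo ?b) = fps_const c * one_minus_tpow n c"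
    unfolding one_minus_tpow_def using b0
    by (metis fps_compose_mult_distrib fps_const_compose)
  then have 1: "(1 + ?b) * (fps_deriv (fps_binomial c) oo ?b) = fps_const c * one_minus_tpow n c"
    using b0 by (simp add: fps_compose_add_distrib)
  have 2: "fps_XD (one_minus_tpow n c) = fps_X * fps_deriv ?b * (fps_deriv (fps_binomial c) oo ?b)"
    unfolding one_minus_tpow_def fps_XD_def using b0 by (simp add: fps_compose_deriv mult_ac)
  \<comment> \<open>Multiplication by \<open>1 - t ^ n\<close> cancels all terms of
    \<open>?A\<close> except the first, at index \<open>n\<close>.\<close>
  have 3: "fps_const c * (fps_X * fps_deriv ?b) = (1 + ?b) * ?A"
  proof -
    have "(fps_const c * fps_XD ?b) $ k = ((1 + ?b) * ?A) $ k" for k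
      using assms
      by (auto simp: algebra_simps fps_X_power_mult_nth dvd_minus_self)
    then show ?thesis by (simp add: fps_eq_iff fps_XD_def del: fps_XD_nth)
  qed
  have "(1 + ?b) * fps_XD (one_minus_tpow n c) = fps_X * fps_deriv ?b * (fps_const c * one_minus_tpow n c)"
    unfolding 2 1 [symmetric] by (simp add: mult_ac)
  also have "\<dots> = (1 + ?b) * (one_minus_tpow n c * ?A)"
    using 3 by (metis (no_types, lifting) mult.assoc mult.commute)
  finally have "(1 + ?b) * fps_XD (one_minus_tpow n c) = (1 + ?b) * (one_minus_tpow n c * ?A)" .
  moreover have "(1 + ?b) $ 0 = 1" using assms by simp
  then have "1 + ?b \<noteq> 0" by (metis fps_zero_nth zero_neq_one)
  ultimately show ?thesis
    by (subst log_deriv_eq_iff) auto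
qed

section \<open>Words, bridges and Dyck words\<close>

text \<open>The path with steps \<open>m - 1 - a_i\<close>. Reading the entries modulo the length
  extends it to all times, so that rotating the word becomes shifting the time.\<close>

definition height :: "nat \<Rightarrow> nat list \<Rightarrow> nat \<Rightarrow> int" where
  "height m a k = (\<Sum>i<k. int m - 1 - int (a ! (i mod length a)))"

lemma height_0 [simp]: "height m a 0 = 0"
  by (simp add: height_def)

lemma height_Suc: "height m a (Suc k) = height m a k + (int m - 1 - int (a ! (k mod length a)))"
  by (simp add: height_def)

text \<open>Summation by parts: the \<open>i\<close>-th step enters exactly the \<open>n - i\<close>
  heights at times \<open>i\<close> to \<open>n - 1\<close>. The weight is thus the signed area
  under the path.\<close>

lemma wt_eq_sum_height: "wt m a = (\<Sum>k<length a. height m a k)"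
proof -
  have "(\<Sum>i=1..n. (int n - int i) * f (i - 1)) = (\<Sum>k<n. \<Sum>i<k. f i)" for n and f :: "nat \<Rightarrow> int"
  proof (induction n)
    case (Suc n)
    have "(\<Sum>i=1..Suc n. (int (Suc n) - int i) * f (i - 1))
        = (\<Sum>i=1..n. (int (Suc n) - int i) * f (i - 1))"
      by simp
    also have "\<dots> = (\<Sum>i=1..n. (int n - int i) * f (i - 1)) + (\<Sum>i=1..n. f (i - 1))"
      by (simp add: algebra_simps flip: sum.distrib)
    also have "(\<Sum>i=1..n. f (i - 1)) = (\<Sum>i<n. f i)"
      by (rule sum.reindex_bij_witness[of _ Suc "\<lambda>i. i - 1"]) auto
    finally show ?case using Suc by simp
  qed simp
  from this[where f = "\<lambda>i. int m - 1 - int (a ! i)"]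
  have "wt m a = (\<Sum>k<length a. \<Sum>i<k. int m - 1 - int (a ! i))"
    unfolding wt_def by simp
  also have "\<dots> = (\<Sum>k<length a. height m a k)"
    unfolding height_def by (intro sum.cong) auto
  finally show ?thesis .
qed

lemma height_length: "height m a (length a) = (int m - 1) * int (length a) - int (sum_list a)"
proof -
  have "height m a (length a) = (\<Sum>i<length a. (int m - 1) - int (a ! i))"
    unfolding height_def by (intro sum.cong) auto
  also have "\<dots> = (int m - 1) * int (length a) - int (\<Sum>i<length a. a ! i)"
    by (simp add: sum_subtractf)
  finally show ?thesis by (simp add: sum_list_sum_nth atLeast0LessThan)
qed

lemma U_iff: "m \<ge> 1 \<Longrightarrow> a \<in> U m n \<longleftrightarrow> length a = n \<and> height m a n = 0"
proof -
  assume "m \<ge> 1"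
  then have "int (sum_list a) = (int m - 1) * int n \<longleftrightarrow> sum_list a = (m - 1) * n"
    by (metis of_nat_1 of_nat_diff of_nat_eq_iff of_nat_mult)
  then show ?thesis by (auto simp: U_def height_length)
qed

lemma length_U: "a \<in> U m n \<Longrightarrow> length a = n"
  by (simp add: U_def)

lemma finite_U [simp]: "finite (U m n)"
proof (rule finite_subset)
  show "U m n \<subseteq> {a. set a \<subseteq> {..(m - 1) * n} \<and> length a = n}"
    by (auto simp: U_def dest: member_le_sum_list)
qed (simp add: finite_lists_length_eq)

lemma height_rotate:
  assumes "a \<noteq> []"
  shows "height m (rotate j a) k = height m a (j + k) - height m a j"
proof (induction k)
  case (Suc k)
  have "rotate j a ! (k mod length a) = a ! ((j + k) mod length a)"
    using assms by (subst nth_rotate) (auto simp: mod_simps)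
  then show ?case using Suc by (simp add: height_Suc)
qed simp

lemma height_add_length:
  assumes "a \<noteq> []"
  shows "height m a (length a + k) = height m a k + height m a (length a)"
  using height_rotate[OF assms, of m "length a" k] by simp

lemma height_periodic:
  assumes "a \<noteq> []" "height m a (length a) = 0"
  shows "height m a (k mod length a) = height m a k"
proof -
  have "height m a (i + length a * j) = height m a i" for i j
  proof (induction j)
    case (Suc j)
    have "height m a (i + length a * Suc j) = height m a (length a + (i + length a * j))"
      by (simp add: algebra_simps)
    then show ?case using Suc height_add_length[OF assms(1), of m] assms(2) by simp
  qed simp
  from this[of "k mod length a" "k div length a"] show ?thesis by simp
qed

lemma height_append1:
  assumes "k \<le> length a"
  shows "height m (a @ b) k = height m a k"
  unfolding height_def using assms by (intro sum.cong) (auto simp: nth_append)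

lemma height_append2:
  assumes "k \<le> length b"
  shows "height m (a @ b) (length a + k) = height m a (length a) + height m b k"
  using assms by (induction k) (auto simp: height_append1 height_Suc)

lemma wt_append:
  assumes "height m a (length a) = 0"
  shows "wt m (a @ b) = wt m a + wt m b"
proof -
  have "(\<Sum>k<l + n. f k) = (\<Sum>k<l. f k) + (\<Sum>k<n. f (l + k))" for f :: "nat \<Rightarrow> int" and l n
    by (induction n) auto
  then show ?thesis
    unfolding wt_eq_sum_height length_append
    by (auto intro!: arg_cong2[of _ _ _ _ "(+)"] sum.cong simp: height_append1 height_append2 assms)
qed

lemma rotate_in_U: "m \<ge> 1 \<Longrightarrow> a \<in> U m n \<Longrightarrow> rotate j a \<in> U m n"
  using height_add_length[of a m j] by (cases "a = []") (auto simp: U_iff height_rotate add.commute)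

text \<open>Rotation by \<open>j\<close> moves the origin to the point at time \<open>j\<close>,
  lowering all \<open>n\<close> heights by \<open>height m a j\<close>; by periodicity the sum over
  a period does not depend on where the period starts. Hence the weight is constant modulo
  \<open>n\<close> on a class and largest when the start is lowest.\<close>

lemma wt_rotate:
  assumes "m \<ge> 1" "a \<in> U m n"
  shows "wt m (rotate j a) = wt m a - int n * height m a j"
proof (cases "a = []")
  case False
  have a: "length a = n" "height m a (length a) = 0"
    using assms by (auto simp: U_iff)
  then have "n > 0" using False by auto
  have "wt m (rotate j a) = (\<Sum>k<n. height m a (j + k)) - int n * height m a j"
    by (simp add: wt_eq_sum_height height_rotate False sum_subtractf a)
  also have "(\<Sum>k<n. height m a (j + k)) = (\<Sum>k<n. height m a k)"
  proof (induction j)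
    case (Suc j)
    have "(\<Sum>k<n. height m a (Suc j + k)) + height m a j = (\<Sum>k<Suc n. height m a (j + k))"
      by (subst sum.lessThan_Suc_shift) simp
    also have "\<dots> = (\<Sum>k<n. height m a (j + k)) + height m a j"
      using height_add_length[OF False, of m j] a by (simp add: add.commute)
    finally show ?case using Suc by simp
  qed simp
  finally show ?thesis by (simp add: wt_eq_sum_height a)
qed (use assms in \<open>auto simp: U_def\<close>)

section \<open>Cyclic classes and their weights\<close>

lemma cyclic_class_rotate [simp]: "cyclic_class (rotate j a) = cyclic_class a"
proof
  show "cyclic_class (rotate j a) \<subseteq> cyclic_class a"
    by (auto simp: cyclic_class_def rotate_rotate)
  have "rotate k a \<in> cyclic_class (rotate j a)" for k
  proof (cases "a = []")
    case False
    \<comment> \<open>Rotation by \<open>length a * j - j\<close> undoes rotation by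
      \<open>j\<close>: together they are a multiple of the full length.\<close>
    have "rotate (k + (length a * j - j) + j) a = rotate k a"
    proof -
      have "j \<le> length a * j" using False by (cases a) auto
      then have "k + (length a * j - j) + j = k + length a * j" using \<open>j \<le> length a * j\<close> by (simp only: add.assoc le_add_diff_inverse2)
      then have "(k + (length a * j - j) + j) mod length a = k mod length a"
        by (simp only: mod_mult_self2)
      then show ?thesis
        using rotate_conv_mod[symmetric, of k a] by (subst rotate_conv_mod) (simp only:)
    qed
    from this[symmetric] show ?thesis
      unfolding cyclic_class_def rotate_rotate
      by (rule range_eqI[where x = "k + (length a * j - j)"])
  qed (auto simp: cyclic_class_def)
  then show "cyclic_class a \<subseteq> cyclic_class (rotate j a)"
    by (auto simp: cyclic_class_def)
qed

lemma cyclic_class_eq_image: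
  assumes "a \<noteq> []"
  shows "cyclic_class a = (\<lambda>k. rotate k a) ` {..<length a}"
proof -
  have "rotate k a \<in> (\<lambda>k. rotate k a) ` {..<length a}" for k
    using assms rotate_conv_mod[of k a] by (intro image_eqI[of _ _ "k mod length a"]) auto
  then show ?thesis by (auto simp: cyclic_class_def)
qed

lemma finite_cyclic_class [simp]: "finite (cyclic_class a)"
  by (cases "a = []") (simp_all add: cyclic_class_eq_image, simp add: cyclic_class_def)

lemma self_in_cyclic_class [simp]: "a \<in> cyclic_class a"
  unfolding cyclic_class_def by (rule image_eqI[of _ _ 0]) auto

lemma class_wt_in: "\<exists>j. class_wt m (cyclic_class a) = wt m (rotate j a)"
proof -
  have "class_wt m (cyclic_class a) \<in> wt m ` cyclic_class a"
    unfolding class_wt_def by (rule Max_in) (auto intro!: self_in_cyclic_class)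
  then show ?thesis by (auto simp: cyclic_class_def)
qed

lemma wt_le_class_wt: "b \<in> cyclic_class a \<Longrightarrow> wt m b \<le> class_wt m (cyclic_class a)"
  unfolding class_wt_def by (rule Max_ge) auto

lemma class_wt_cong:
  assumes "m \<ge> 1" "a \<in> U m n"
  shows "[class_wt m (cyclic_class a) = wt m a] (mod int n)"
proof -
  obtain j where "class_wt m (cyclic_class a) = wt m (rotate j a)"
    using class_wt_in by blast
  then show ?thesis using wt_rotate[OF assms]
    by (simp add: cong_iff_dvd_diff)
qed

section \<open>Dyck words and minima of periodic paths\<close>

definition Dyck :: "nat \<Rightarrow> nat \<Rightarrow> nat list set" where
  "Dyck m n = {a \<in> U m n. \<forall>k\<le>n. height m a k \<ge> 0}"

lemma finite_Dyck [simp]: "finite (Dyck m n)"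
  by (simp add: Dyck_def)

lemma height_Dyck_nonneg:
  assumes "m \<ge> 1" "a \<in> Dyck m n" "n > 0"
  shows "height m a k \<ge> 0"
proof -
  have a: "length a = n" "height m a (length a) = 0" "a \<noteq> []"
    using assms by (auto simp: Dyck_def U_iff)
  have "k mod length a \<le> n" using a by (simp add: less_imp_le assms(3))
  then have "height m a (k mod length a) \<ge> 0"
    using assms(2) by (simp add: Dyck_def)
  then show ?thesis using height_periodic a by metis
qed

text \<open>Every rotation loses \<open>n\<close> times a nonnegative height, so a Dyck word attains
  the maximum of its class.\<close>

lemma class_wt_Dyck:
  assumes "m \<ge> 1" "a \<in> Dyck m n" "n > 0"
  shows "class_wt m (cyclic_class a) = wt m a"
proof (rule antisym)
  obtain j where "class_wt m (cyclic_class a) = wt m (rotate j a)"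
    using class_wt_in by blast
  moreover have "int n * height m a j \<ge> 0" using height_Dyck_nonneg[OF assms] by simp
  ultimately show "class_wt m (cyclic_class a) \<le> wt m a"
    using wt_rotate[OF assms(1), of a n j] assms(2) by (simp add: Dyck_def)
qed (rule wt_le_class_wt[OF self_in_cyclic_class])

text \<open>Time 0 is excluded, so that for a nonempty bridge the value lies between 1 and the
  length; for a nonempty Dyck word it is the first return to 0.\<close>

definition first_min :: "nat \<Rightarrow> nat list \<Rightarrow> nat" where
  "first_min m a = (LEAST p. 0 < p \<and> (\<forall>k. height m a p \<le> height m a k))"

lemma first_min:
  assumes "m \<ge> 1" "a \<in> U m n" "n > 0"
  defines "p \<equiv> first_min m a"
  shows "0 < p" "p \<le> n" "height m a p \<le> height m a k" "0 < i \<Longrightarrow> i < p \<Longrightarrow> height m a p < height m a i"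
proof -
  have a: "length a = n" "height m a (length a) = 0" "a \<noteq> []"
    using assms by (auto simp: U_iff)
  have fin: "finite (height m a ` {..<n})" "height m a ` {..<n} \<noteq> {}" using assms by auto
  obtain k0 where k0: "k0 < n" "height m a k0 = Min (height m a ` {..<n})"
    using Min_in[OF fin] by auto
  have min: "height m a k0 \<le> height m a k" for k
  proof -
    have "height m a k0 \<le> height m a (k mod n)"
      unfolding k0(2) using assms by (intro Min_le) auto
    then show ?thesis using height_periodic[OF a(3,2)] a(1) by simp
  qed
  define P where "P = (\<lambda>p. 0 < p \<and> (\<forall>k. height m a p \<le> height m a k))"
  \<comment> \<open>A minimum at time 0 recurs at time \<open>n\<close>, which provides a positive
    witness in that case too.\<close>
  have "\<exists>p. P p \<and> p \<le> n"
  proof (cases "k0 = 0")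
    case True
    then have "P n" unfolding P_def using assms(3) a(1,2) min by simp
    then show ?thesis by blast
  next
    case False
    then have "P k0" unfolding P_def using min by blast
    then show ?thesis using k0(1) less_imp_le by blast
  qed
  then obtain q where q: "P q" "q \<le> n" by blast
  have p_def: "p = (LEAST p. P p)" unfolding assms(4) first_min_def P_def ..
  have p: "P p" "p \<le> n"
    unfolding p_def using LeastI[of P, OF q(1)] Least_le[of P, OF q(1)] q(2) by simp_all
  show p': "0 < p" "p \<le> n" "\<And>k. height m a p \<le> height m a k"
    using p unfolding P_def by blast+
  show "height m a p < height m a i" if i: "0 < i" "i < p"
  proof -
    have "\<not> P i" using not_less_Least[of i P] i unfolding p_def by blast
    then have "\<not> (\<forall>k. height m a i \<le> height m a k)" using i(1) unfolding P_def by blast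
    then obtain k where "height m a k < height m a i" by (meson not_le)
    moreover have "height m a p \<le> height m a k" by (rule p'(3))
    ultimately show ?thesis by simp
  qed
qed

text \<open>A rotation starting at a minimum has only nonnegative heights, hence nonnegative area.
  This makes the class sums polynomials in \<open>q\<close>.\<close>

lemma class_wt_nonneg:
  assumes "m \<ge> 1" "a \<in> U m n" "n > 0"
  shows "class_wt m (cyclic_class a) \<ge> 0"
proof -
  define p where "p = first_min m a"
  have p: "height m a p \<le> height m a k" for k unfolding p_def by (rule first_min(3)[OF assms])
  have "a \<noteq> []" using assms by (auto simp: U_def)
  then have "wt m (rotate p a) \<ge> 0"
    unfolding wt_eq_sum_height by (intro sum_nonneg) (simp add: height_rotate p)
  moreover have "wt m (rotate p a) \<le> class_wt m (cyclic_class a)"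
    by (rule wt_le_class_wt) (simp add: cyclic_class_def)
  ultimately show ?thesis by simp
qed

definition bridge_sum :: "nat \<Rightarrow> nat \<Rightarrow> 'a::field \<Rightarrow> 'a" where
  "bridge_sum m n x = (\<Sum>a\<in>U m n. x powi class_wt m (cyclic_class a))"

definition Dyck_sum :: "nat \<Rightarrow> nat \<Rightarrow> 'a::field \<Rightarrow> 'a" where
  "Dyck_sum m n x = (\<Sum>a\<in>Dyck m n. x powi wt m a)"

lemma append_Dyck:
  assumes "m \<ge> 1" "a \<in> Dyck m k" "b \<in> Dyck m l"
  shows "a @ b \<in> Dyck m (k + l)"
proof -
  have ab: "length a = k" "height m a k = 0" "length b = l" "height m b l = 0"
    using assms by (auto simp: Dyck_def U_iff)
  have "height m (a @ b) i \<ge> 0" if "i \<le> k + l" for i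
  proof (cases "i \<le> k")
    case True
    then show ?thesis using assms ab by (simp add: height_append1 Dyck_def)
  next
    case False
    define j where "j = i - k"
    have "height m (a @ b) (length a + j) = height m a (length a) + height m b j"
      using False that ab by (intro height_append2) (simp add: j_def)
    moreover have "height m b j \<ge> 0" using assms(3) False that by (simp add: Dyck_def j_def)
    ultimately show ?thesis using ab False by (simp add: j_def)
  qed
  moreover have "height m (a @ b) (k + l) = 0"
    using height_append2[of l b m a] ab by simp
  ultimately show ?thesis using ab assms(1) by (simp add: Dyck_def U_iff)
qed

lemma split_Dyck:
  assumes "m \<ge> 1" "D \<in> Dyck m n" "r \<le> n" "height m D r = 0"
  shows "take r D \<in> Dyck m r" "drop r D \<in> Dyck m (n - r)"
proof -
  have D: "length D = n" "height m D n = 0" "\<And>k. k \<le> n \<Longrightarrow> height m D k \<ge> 0"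
    using assms by (auto simp: Dyck_def U_iff)
  have t: "height m (take r D) k = height m D k" if "k \<le> r" for k
    using height_append1[of k "take r D" m "drop r D"] that D assms by simp
  have d: "height m (drop r D) k = height m D (r + k)" if "k \<le> n - r" for k
    using height_append2[of k "drop r D" m "take r D"] that D assms t by simp
  show "take r D \<in> Dyck m r" "drop r D \<in> Dyck m (n - r)"
    using assms D by (auto simp: Dyck_def U_iff t d)
qed

text \<open>
  A Dyck word with a marked step is cut at the first return to \<open>0\<close> after the mark, and the left part
  is rotated so as to start at the mark. Conversely, a bridge determines the mark through its first
  minimum at a positive time.
\<close>

lemma of_nat_times_Dyck_sum:
  fixes x :: "'a::field"
  assumes m: "m \<ge> 1" and x: "x \<noteq> 0"
  shows "of_nat n * Dyck_sum m n x = (\<Sum>M=1..n. bridge_sum m M x * Dyck_sum m (n - M) x)"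
proof -
  define R where "R = (\<lambda>D j. LEAST r. j < r \<and> height m D r = 0)"
  define P where "P = first_min m"
  define T where "T = (SIGMA M:{1..n}. U m M \<times> Dyck m (n - M))"
  have "of_nat n * Dyck_sum m n x = (\<Sum>(D,j)\<in>Dyck m n \<times> {..<n}. x powi wt m D)"
    by (simp add: Dyck_sum_def sum_distrib_left flip: sum.cartesian_product)
  also have "\<dots> = (\<Sum>(M,a,D)\<in>T. x powi class_wt m (cyclic_class a) * x powi wt m D)"
  \<comment> \<open>Goals 1 and 3 say that the two maps are mutually inverse, 2 and 4 that they land
    in the index sets, 5 that the summands agree. In the inverse map the start of \<open>a\<close>
    lands at \<open>M - P a\<close> after the rotation by \<open>P a\<close>, which is therefore the
    mark.\<close>
  proof (rule sum.reindex_bij_witness[of _ "\<lambda>(M,a,D). (rotate (P a) a @ D, M - P a)"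
        "\<lambda>(D,j). (R D j, rotate j (take (R D j) D), drop (R D j) D)"], goal_cases)
    case (1 z)
    then obtain D j where z: "z = (D, j)" "D \<in> Dyck m n" "j < n" by auto
    define r where "r = R D j"
    have D: "length D = n" "height m D n = 0" "\<And>k. k \<le> n \<Longrightarrow> height m D k \<ge> 0"
      using z m by (auto simp: Dyck_def U_iff)
    have r: "j < r" "height m D r = 0" "r \<le> n"
      using LeastI[of "\<lambda>r. j < r \<and> height m D r = 0" n] Least_le[of "\<lambda>r. j < r \<and> height m D r = 0" n] z D
      by (auto simp: r_def R_def)
    have r_min: "height m D k > 0" if "j < k" "k < r" for k
      using not_less_Least[of k "\<lambda>r. j < r \<and> height m D r = 0"] that r D(3)[of k]
      by (auto simp: r_def R_def)
    define E where "E = take r D"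
    have E: "E \<in> Dyck m r" unfolding E_def using split_Dyck[OF m z(2) r(3,2)] by simp
    have E_height: "height m E k = height m D k" if "k \<le> r" for k
      using height_append1[of k E m "drop r D"] that D r by (simp add: E_def)
    have E_len: "length E = r" "E \<noteq> []" using D r by (auto simp: E_def)
    \<comment> \<open>Seen from the mark, the path is above its minimum until the return at
      \<open>r\<close>: it is positive strictly between \<open>j\<close> and \<open>r\<close>, and 0
      is the least height of the Dyck word \<open>E\<close>.\<close>
    have "P (rotate j E) = r - j"
      unfolding P_def first_min_def
    proof (rule Least_equality)
      show "0 < r - j \<and> (\<forall>k. height m (rotate j E) (r - j) \<le> height m (rotate j E) k)"
        using r E_len E_height height_Dyck_nonneg[OF m E] by (auto simp: height_rotate)
      show "r - j \<le> y" if y: "0 < y \<and> (\<forall>k. height m (rotate j E) y \<le> height m (rotate j E) k)" for y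
      proof (rule ccontr)
        assume "\<not> r - j \<le> y"
        then have "height m E (j + y) > 0"
          using r_min[of "j + y"] y by (simp add: E_height)
        moreover have "height m E (j + y) \<le> height m E (j + (r - j))"
          using y E_len by (auto simp: height_rotate)
        ultimately show False using r E_height by simp
      qed
    qed
    moreover have "rotate (r - j) (rotate j E) = E"
      using r E_len by (simp add: rotate_rotate)
    ultimately show ?case
      using z r by (simp flip: r_def E_def) (simp add: E_def)
  next
    case (2 z)
    then obtain D j where z: "z = (D, j)" "D \<in> Dyck m n" "j < n" by auto
    define r where "r = R D j"
    have D: "height m D n = 0"
      using z m by (auto simp: Dyck_def U_iff)
    have r: "j < r" "height m D r = 0" "r \<le> n"
      using LeastI[of "\<lambda>r. j < r \<and> height m D r = 0" n] Least_le[of "\<lambda>r. j < r \<and> height m D r = 0" n] z D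
      by (auto simp: r_def R_def)
    have "take r D \<in> U m r" using split_Dyck[OF m z(2) r(3,2)] by (simp add: Dyck_def)
    then show ?case
      using z r split_Dyck[OF m z(2) r(3,2)] m by (auto simp: T_def rotate_in_U simp flip: r_def)
  next
    case (3 z)
    then obtain M a D where z: "z = (M, a, D)" "1 \<le> M" "M \<le> n" "a \<in> U m M" "D \<in> Dyck m (n - M)"
      by (auto simp: T_def)
    define p where "p = P a"
    have "M > 0" using z(2) by simp
    note p = first_min[OF m z(4) this, folded P_def, folded p_def]
    have a: "length a = M" "a \<noteq> []" "height m a M = 0" using z m by (auto simp: U_iff)
    define E where "E = rotate p a"
    have E_len: "length E = M" using a by (simp add: E_def)
    have E0: "height m E M = 0" using a height_add_length[of a m p] by (simp add: E_def height_rotate add.commute)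
    \<comment> \<open>A zero of \<open>E\<close> at a time \<open>y\<close> strictly between
      \<open>M - p\<close> and \<open>M\<close> would be a visit of \<open>a\<close> to its minimum
      at the positive time \<open>p + y - M\<close>, before the first such time
      \<open>p\<close>.\<close>
    have "R (E @ D) (M - p) = M"
      unfolding R_def
    proof (rule Least_equality)
      show "M - p < M \<and> height m (E @ D) M = 0"
        using E0 E_len z(2) p by (simp add: height_append1)
      show "M \<le> y" if y: "M - p < y \<and> height m (E @ D) y = 0" for y
      proof (rule ccontr)
        assume "\<not> M \<le> y"
        then have "height m E y = 0" using y E_len by (simp add: height_append1)
        then have "height m a (p + y) = height m a p" using a by (simp add: E_def height_rotate)
        moreover have "p + y = length a + (p + y - M)" using conjunct1[OF y] a(1) by linarith
        ultimately have "height m a (p + y - M) = height m a p"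
          using a height_add_length[of a m "p + y - M"] by simp
        moreover have "height m a p < height m a (p + y - M)"
        proof (rule p(4))
          show "0 < p + y - M" "p + y - M < p"
            using conjunct1[OF y] \<open>\<not> M \<le> y\<close> by linarith+
        qed
        ultimately show False by simp
      qed
    qed
    moreover have "rotate (M - p) E = a" using p a by (simp add: E_def rotate_rotate)
    ultimately show ?case
      using z E_len by (simp flip: p_def E_def)
  next
    case (4 z)
    then obtain M a D where z: "z = (M, a, D)" "1 \<le> M" "M \<le> n" "a \<in> U m M" "D \<in> Dyck m (n - M)"
      by (auto simp: T_def)
    define p where "p = P a"
    have "M > 0" using z(2) by simp
    note p = first_min[OF m z(4) this, folded P_def, folded p_def]
    have "a \<noteq> []" using z by (auto simp: U_def)
    then have "rotate p a \<in> Dyck m M"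
      using rotate_in_U[OF m z(4)] p by (simp add: Dyck_def height_rotate)
    then have "rotate p a @ D \<in> Dyck m (M + (n - M))" using append_Dyck[OF m] z by blast
    then show ?case using z p by (simp flip: p_def)
  next
    case (5 z)
    then obtain D j where z: "z = (D, j)" "D \<in> Dyck m n" "j < n" by auto
    define r where "r = R D j"
    have D: "height m D n = 0"
      using z m by (auto simp: Dyck_def U_iff)
    have r: "j < r" "height m D r = 0" "r \<le> n"
      using LeastI[of "\<lambda>r. j < r \<and> height m D r = 0" n] Least_le[of "\<lambda>r. j < r \<and> height m D r = 0" n] z D
      by (auto simp: r_def R_def)
    note Dr = split_Dyck[OF m z(2) r(3,2)]
    have "class_wt m (cyclic_class (take r D)) = wt m (take r D)"
      using class_wt_Dyck[OF m Dr(1)] r by simp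
    moreover have "wt m D = wt m (take r D) + wt m (drop r D)"
      using wt_append[of m "take r D" "drop r D"] Dr(1) m by (simp add: Dyck_def U_iff)
    ultimately show ?case using z x by (simp add: power_int_add flip: r_def)
  qed
  also have "\<dots> = (\<Sum>M=1..n. \<Sum>(a,D)\<in>U m M \<times> Dyck m (n - M).
      x powi class_wt m (cyclic_class a) * x powi wt m D)"
    unfolding T_def by (subst sum.Sigma) auto
  also have "\<dots> = (\<Sum>M=1..n. bridge_sum m M x * Dyck_sum m (n - M) x)"
    by (simp add: bridge_sum_def Dyck_sum_def sum_product sum.cartesian_product)
  finally show ?thesis .
qed

section \<open>Primitive words and their repetitions\<close>

abbreviation repeated :: "nat \<Rightarrow> 'a list \<Rightarrow> 'a list" where
  "repeated r b \<equiv> concat (replicate r b)"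

lemma length_repeated [simp]: "length (repeated r b) = r * length b"
  by (induction r) auto

lemma nth_repeated:
  "i < r * length b \<Longrightarrow> repeated r b ! i = b ! (i mod length b)"
proof (induction r arbitrary: i)
  case (Suc r)
  show ?case
  proof (cases "i < length b")
    case False
    then have "repeated (Suc r) b ! i = repeated r b ! (i - length b)"
      by (simp add: nth_append)
    also have "\<dots> = b ! ((i - length b) mod length b)"
      using Suc.prems False by (intro Suc.IH) auto
    finally show ?thesis using False by (simp add: le_mod_geq)
  qed (simp add: nth_append)
qed simp

lemma repeated_inject:
  assumes "r > 0" "length b = length c"
  shows "repeated r b = repeated r c \<longleftrightarrow> b = c"
proof
  assume "repeated r b = repeated r c"
  moreover have "take (length d) (repeated r d) = d" for d :: "'a list"
    using assms(1) by (cases r) auto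
  ultimately show "b = c" using assms(2) by metis
qed simp

lemma rotate_repeated: "rotate k (repeated r b) = repeated r (rotate k b)"
proof (cases "b = []")
  case False
  show ?thesis
  proof (rule nth_equalityI)
    fix i assume "i < length (rotate k (repeated r b))"
    then have i: "i < r * length b" by simp
    then have "(k + i) mod (r * length b) < r * length b"
      by (metis gr_implies_not_zero mod_less_divisor neq0_conv)
    then have "rotate k (repeated r b) ! i = b ! ((k + i) mod length b)"
      using i by (simp add: nth_rotate nth_repeated mod_mod_cancel)
    also have "\<dots> = repeated r (rotate k b) ! i"
      using i False by (simp add: nth_rotate nth_repeated mod_add_right_eq)
    finally show "rotate k (repeated r b) ! i = repeated r (rotate k b) ! i" .
  qed simp
qed simp

lemma wt_repeated:
  assumes "m \<ge> 1" "b \<in> U m n"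
  shows "wt m (repeated r b) = int r * wt m b"
proof (induction r)
  case (Suc r)
  have "height m b (length b) = 0" using assms by (auto simp: U_iff)
  then show ?case using Suc by (simp add: wt_append algebra_simps)
qed (simp add: wt_def)

lemma repeated_in_U: "b \<in> U m n \<Longrightarrow> repeated r b \<in> U m (r * n)"
  by (induction r) (auto simp: U_def algebra_simps)

lemma cyclic_class_repeated: "cyclic_class (repeated r b) = repeated r ` cyclic_class b"
  by (auto simp: cyclic_class_def rotate_repeated)

text \<open>A bridge ends at 0, so the areas of its copies add up, and taking the maximum commutes
  with multiplication by \<open>r\<close>. On generating sums, repetition thus becomes the
  substitution of \<open>x ^ r\<close> for \<open>x\<close>.\<close>

lemma class_wt_repeated:
  assumes "m \<ge> 1" "b \<in> U m n"
  shows "class_wt m (cyclic_class (repeated r b)) = int r * class_wt m (cyclic_class b)"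
proof -
  have wt: "wt m (repeated r c) = int r * wt m c" if "c \<in> cyclic_class b" for c
    using that assms rotate_in_U[OF assms(1,2)] wt_repeated[OF assms(1)] by (auto simp: cyclic_class_def)
  have "class_wt m (cyclic_class (repeated r b)) = Max ((\<lambda>c. int r * wt m c) ` cyclic_class b)"
    unfolding class_wt_def cyclic_class_repeated image_image
    by (intro arg_cong[where f = Max] image_cong) (auto simp: wt)
  also have "\<dots> = Max ((*) (int r) ` wt m ` cyclic_class b)"
    by (simp add: image_image)
  also have "\<dots> = int r * Max (wt m ` cyclic_class b)"
    by (intro mono_Max_commute[symmetric] monoI mult_left_mono)
       (auto intro: self_in_cyclic_class)
  finally show ?thesis by (simp add: class_wt_def)
qed

lemma powi_class_wt_repeated:
  fixes x :: "'a::field"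
  assumes "m \<ge> 1" "b \<in> U_prim m n"
  shows "x powi class_wt m (cyclic_class (repeated r b)) = (x ^ r) powi class_wt m (cyclic_class b)"
proof -
  have "b \<in> U m n" using assms(2) by (simp add: U_prim_def)
  then show ?thesis by (simp add: class_wt_repeated[OF assms(1)] power_int_mult)
qed

section \<open>Periods of words and primitive roots\<close>

lemma rotate_mod_period:
  assumes "rotate d a = a"
  shows "rotate (k mod d) a = rotate k a"
proof -
  have "rotate (i + d * j) a = rotate i a" for i j
  proof (induction j)
    case (Suc j)
    have "rotate (i + d * Suc j) a = rotate (i + d * j) (rotate d a)"
      unfolding rotate_rotate by (simp add: algebra_simps)
    then show ?case using Suc assms by simp
  qed simp
  from this[of "k mod d" "k div d"] show ?thesis by simp
qed

lemma primitive_rotate_iff: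
  assumes "primitive b" "b \<noteq> []"
  shows "rotate k b = b \<longleftrightarrow> length b dvd k"
proof
  assume *: "rotate k b = b"
  show "length b dvd k"
  proof (rule ccontr)
    assume "\<not> length b dvd k"
    then have "k mod length b \<in> {1..<length b}"
      using assms by (auto simp: Suc_le_eq mod_greater_zero_iff_not_dvd)
    moreover have "rotate (k mod length b) b = b" using * by (simp flip: rotate_conv_mod)
    ultimately show False using assms unfolding primitive_def by blast
  qed
qed simp

lemma primitive_rotate:
  assumes "primitive b"
  shows "primitive (rotate j b)"
proof (cases "b = []")
  case False
  have "rotate k (rotate j b) \<noteq> rotate j b" if k: "k \<in> {1..<length b}" for k
  proof
    assume "rotate k (rotate j b) = rotate j b"
    then have eq: "rotate j (rotate k b) = rotate j b" by (simp add: rotate_rotate add.commute)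
    have "inj (rotate j :: 'b list \<Rightarrow> 'b list)" for j
      unfolding rotate_def by (rule inj_fn[OF inj_rotate1])
    with eq have "rotate k b = b" by (metis injD)
    then show False using k assms unfolding primitive_def by blast
  qed
  then show ?thesis by (simp add: primitive_def)
qed (use assms in simp)

lemma finite_U_prim [simp]: "finite (U_prim m n)"
  by (simp add: U_prim_def)

definition prim_sum :: "nat \<Rightarrow> nat \<Rightarrow> 'a::field \<Rightarrow> 'a" where
  "prim_sum m n x = (\<Sum>a\<in>U_prim m n. x powi class_wt m (cyclic_class a))"

text \<open>Let \<open>d\<close> be the least positive rotation fixing the word. Minimality forces
  \<open>d\<close> to divide \<open>N\<close>, since \<open>N mod d\<close> is again a period, and
  it makes the prefix of length \<open>d\<close> primitive; the word is a repetition of that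
  prefix.\<close>

lemma U_eq_UN_repeated:
  assumes "N > 0"
  shows "U m N = (\<Union>n\<in>{n. n dvd N}. repeated (N div n) ` U_prim m n)"
proof (intro equalityI subsetI)
  fix a assume a: "a \<in> U m N"
  have N: "length a = N" using a by (simp add: length_U)
  define P where "P = (\<lambda>d. 0 < d \<and> rotate d a = a)"
  define d where "d = (LEAST d. P d)"
  have "P N" using assms N by (simp add: P_def)
  then have d: "P d" unfolding d_def by (rule LeastI)
  then have d0: "d > 0" "rotate d a = a" by (auto simp: P_def)
  have d_min: "\<not> (0 < k \<and> rotate k a = a)" if "k < d" for k
    using not_less_Least[of k P] that unfolding d_def P_def by blast
  have "rotate (N mod d) a = a"
    using rotate_mod_period[OF d0(2), of N] N by simp
  then have "\<not> 0 < N mod d" using d_min[of "N mod d"] d0(1) by simp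
  then have dN: "d dvd N" by auto
  then have dle: "d \<le> N" using assms by (rule dvd_imp_le)
  define b where "b = take d a"
  have b: "length b = d" using dle N by (simp add: b_def)
  have ab: "a = repeated (N div d) b"
  proof (rule nth_equalityI)
    show len: "length a = length (repeated (N div d) b)" using N b dN by simp
    fix i assume i: "i < length a"
    have "a ! i = a ! (i mod d)"
    proof -
      have "rotate (i - i mod d) a = rotate ((i - i mod d) mod d) a"
        by (rule rotate_mod_period[OF d0(2), symmetric])
      also have "(i - i mod d) mod d = 0" by (simp add: minus_mod_eq_mult_div)
      finally have "rotate (i - i mod d) a = a" by simp
      moreover have "rotate (i - i mod d) a ! (i mod d) = a ! ((i - i mod d + i mod d) mod length a)"
        using i by (intro nth_rotate) (meson le_less_trans mod_less_eq_dividend)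
      moreover have "i - i mod d + i mod d = i" by simp
      ultimately show ?thesis using i by simp
    qed
    moreover have "i mod d < d" using d0 by simp
    ultimately show "a ! i = repeated (N div d) b ! i"
      using i len by (simp add: nth_repeated b) (simp add: b_def)
  qed
  have "sum_list a = (N div d) * sum_list b"
  proof -
    have "sum_list (repeated r b) = r * sum_list b" for r by (induction r) auto
    then show ?thesis using ab by metis
  qed
  moreover have "sum_list a = (m - 1) * ((N div d) * d)" using a dN by (simp add: U_def)
  ultimately have "(N div d) * sum_list b = (N div d) * ((m - 1) * d)"
    by (metis mult.left_commute)
  moreover have "N div d > 0" using dle d0 by (simp add: div_greater_zero_iff)
  ultimately have "sum_list b = (m - 1) * d" by simp
  moreover have "primitive b"
    unfolding primitive_def
  proof
    fix k assume k: "k \<in> {1..<length b}"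
    show "rotate k b \<noteq> b"
    proof
      assume "rotate k b = b"
      then have "rotate k a = a" by (subst (1 2) ab) (simp add: rotate_repeated)
      then show False using d_min[of k] k b by simp
    qed
  qed
  ultimately have "b \<in> U_prim m d" using b by (simp add: U_prim_def U_def)
  then show "a \<in> (\<Union>n\<in>{n. n dvd N}. repeated (N div n) ` U_prim m n)" using ab dN by blast
next
  fix a assume "a \<in> (\<Union>n\<in>{n. n dvd N}. repeated (N div n) ` U_prim m n)"
  then obtain n b where "n dvd N" "b \<in> U m n" "a = repeated (N div n) b"
    by (auto simp: U_prim_def)
  then show "a \<in> U m N" using repeated_in_U[of b m n "N div n"] by simp
qed

text \<open>The length of the primitive root can be read off the word: a rotation by
  \<open>k\<close> fixes the word exactly when this length divides \<open>k\<close>.\<close>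

lemma repeated_primitive_disjoint:
  assumes "N > 0" "n dvd N" "n' dvd N" "b \<in> U_prim m n" "b' \<in> U_prim m n'"
    "repeated (N div n) b = repeated (N div n') b'"
  shows "n = n'"
proof -
  have *: "rotate k (repeated (N div n) b) = repeated (N div n) b \<longleftrightarrow> n dvd k"
    if "n dvd N" "b \<in> U_prim m n" for n b k
  proof -
    have b: "length b = n" "primitive b" using that by (auto simp: U_prim_def U_def)
    have "n > 0" using that assms(1) by (auto intro!: Nat.gr0I)
    have "N div n > 0" using that assms(1) by (auto elim!: dvdE)
    with \<open>n > 0\<close> show ?thesis using b primitive_rotate_iff[of b k]
      by (auto simp: rotate_repeated repeated_inject)
  qed
  have "n dvd k \<longleftrightarrow> n' dvd k" for k
    using *[OF assms(2,4), of k] *[OF assms(3,5), of k] assms(6) by simp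
  then show ?thesis by (meson dvd_antisym dvd_refl)
qed

lemma inj_on_repeated_U_prim: "r > 0 \<Longrightarrow> inj_on (repeated r) (U_prim m n)"
  by (auto simp: inj_on_def U_prim_def repeated_inject length_U)

lemma bridge_sum_eq_prim_sum:
  fixes x :: "'a::field"
  assumes "m \<ge> 1" "N > 0"
  shows "bridge_sum m N x = (\<Sum>n | n dvd N. prim_sum m n (x ^ (N div n)))"
proof -
  have "bridge_sum m N x
      = (\<Sum>n | n dvd N. \<Sum>a\<in>repeated (N div n) ` U_prim m n. x powi class_wt m (cyclic_class a))"
    unfolding bridge_sum_def U_eq_UN_repeated[OF assms(2)]
    using assms(2) by (intro sum.UNION_disjoint) (auto dest: repeated_primitive_disjoint)
  also have "\<dots> = (\<Sum>n | n dvd N. prim_sum m n (x ^ (N div n)))"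
  proof (intro sum.cong refl)
    fix n assume "n \<in> {n. n dvd N}"
    then have "N div n > 0" using assms(2) by (auto elim!: dvdE)
    then have "(\<Sum>a\<in>repeated (N div n) ` U_prim m n. x powi class_wt m (cyclic_class a))
        = (\<Sum>b\<in>U_prim m n. x powi class_wt m (cyclic_class (repeated (N div n) b)))"
      by (simp add: sum.reindex inj_on_repeated_U_prim)
    also have "\<dots> = prim_sum m n (x ^ (N div n))"
      unfolding prim_sum_def
      by (intro sum.cong refl powi_class_wt_repeated[OF assms(1)])
    finally show "(\<Sum>a\<in>repeated (N div n) ` U_prim m n. x powi class_wt m (cyclic_class a))
        = prim_sum m n (x ^ (N div n))" .
  qed
  finally show ?thesis .
qed

section \<open>Class sums and the sign correction\<close>

definition plus_sum :: "nat \<Rightarrow> nat \<Rightarrow> 'a::field \<Rightarrow> 'a" where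
  "plus_sum m n x = (\<Sum>C\<in>U_prim_plus_classes m n. x powi class_wt m C)"

lemma sum_cyclic_classes:
  fixes f :: "nat list set \<Rightarrow> 'a::comm_semiring_1"
  assumes "finite A" "\<And>a j. a \<in> A \<Longrightarrow> rotate j a \<in> A" "\<And>a. a \<in> A \<Longrightarrow> card (cyclic_class a) = c"
  shows "of_nat c * (\<Sum>C\<in>cyclic_class ` A. f C) = (\<Sum>a\<in>A. f (cyclic_class a))"
proof -
  have "(\<Sum>a\<in>A. f (cyclic_class a))
      = (\<Sum>C\<in>cyclic_class ` A. \<Sum>a\<in>{a\<in>A. cyclic_class a = C}. f (cyclic_class a))"
    using assms(1) by (intro sum.group[symmetric]) auto
  also have "\<dots> = (\<Sum>C\<in>cyclic_class ` A. of_nat c * f C)"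
  proof (intro sum.cong refl)
    fix C assume "C \<in> cyclic_class ` A"
    then obtain a where a: "a \<in> A" "C = cyclic_class a" by auto
    have "{b\<in>A. cyclic_class b = C} = cyclic_class a"
      using a assms(2) self_in_cyclic_class by (auto simp: cyclic_class_def[of a])
    then have "card {b\<in>A. cyclic_class b = C} = c" using assms(3)[OF a(1)] by simp
    moreover have "(\<Sum>b\<in>{b\<in>A. cyclic_class b = C}. f (cyclic_class b))
        = (\<Sum>b\<in>{b\<in>A. cyclic_class b = C}. f C)"
      by (intro sum.cong) auto
    ultimately show "(\<Sum>b\<in>{b\<in>A. cyclic_class b = C}. f (cyclic_class b)) = of_nat c * f C"
      by simp
  qed
  finally show ?thesis by (simp add: sum_distrib_left)
qed

lemma card_cyclic_class_primitive:
  assumes "primitive b"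
  shows "card (cyclic_class b) = (if b = [] then 1 else length b)"
proof (cases "b = []")
  case False
  have "inj_on (\<lambda>k. rotate k b) {..<length b}"
  proof (rule linorder_inj_onI)
    fix i j assume ij: "i < j" "i \<in> {..<length b}" "j \<in> {..<length b}"
    show "rotate i b \<noteq> rotate j b"
    proof
      assume eq: "rotate i b = rotate j b"
      have "rotate (j - i) (rotate i b) = rotate j b" using ij by (simp add: rotate_rotate)
      with eq have "rotate (j - i) (rotate i b) = rotate i b" by simp
      moreover have "j - i \<in> {1..<length (rotate i b)}" using ij by auto
      ultimately show False using primitive_rotate[OF assms, of i] unfolding primitive_def by blast
    qed
  qed auto
  then show ?thesis using False by (simp add: cyclic_class_eq_image card_image)
qed (simp add: cyclic_class_def)

lemma rotate_in_U_prim: "m \<ge> 1 \<Longrightarrow> b \<in> U_prim m n \<Longrightarrow> rotate j b \<in> U_prim m n"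
  by (simp add: U_prim_def rotate_in_U primitive_rotate)

lemma of_nat_times_prim_class_sum:
  fixes x :: "'a::field"
  assumes "m \<ge> 1" "n > 0"
  shows "of_nat n * (\<Sum>C\<in>cyclic_class ` U_prim m n. x powi class_wt m C) = prim_sum m n x"
  unfolding prim_sum_def using assms
  by (intro sum_cyclic_classes rotate_in_U_prim finite_U_prim)
     (auto simp: U_prim_def U_def card_cyclic_class_primitive)

lemma U_dprim_half:
  assumes "n mod 4 = 2"
  shows "U_dprim m n (n div 2) = repeated 2 ` U_prim m (n div 2)"
proof -
  have *: "2 * (n div 2) = n" "n div 2 \<noteq> 0" using assms by presburger+
  then have "n div (n div 2) = 2" by (metis nonzero_mult_div_cancel_right)
  then show ?thesis
    using repeated_in_U[of _ m "n div 2" 2] * by (auto simp: U_dprim_def U_prim_def)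
qed

text \<open>A primitive class has \<open>n\<close> elements, which cancels the factor
  \<open>n\<close>. The class of a doubled primitive word has only \<open>n div 2\<close>, whence
  the factor 2; its weight is doubled, whence the argument \<open>x\<^sup>2\<close>.\<close>

lemma of_nat_times_plus_sum:
  fixes x :: "'a::field"
  assumes "m \<ge> 1" "n > 0"
  shows "of_nat n * plus_sum m n x = prim_sum m n x
    + (if even m \<and> n mod 4 = 2 then 2 * prim_sum m (n div 2) (x\<^sup>2) else 0)"
proof (cases "even m \<and> n mod 4 = 2")
  case True
  define h where "h = n div 2"
  have h: "n = 2 * h" "h > 0" using True assms unfolding h_def by presburger+
  define A where "A = repeated 2 ` U_prim m h"
  define S where "S = (\<lambda>A. \<Sum>C\<in>cyclic_class ` A. x powi class_wt m C)"
  have "cyclic_class ` U_prim m n \<inter> cyclic_class ` A = {}"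
  proof (rule ccontr)
    assume "cyclic_class ` U_prim m n \<inter> cyclic_class ` A \<noteq> {}"
    then obtain a b where ab: "a \<in> U_prim m n" "b \<in> U_prim m h"
      "cyclic_class a = cyclic_class (repeated 2 b)" by (auto simp: A_def)
    have "repeated 2 b \<in> cyclic_class a" using ab(3) by simp
    then have *: "repeated 2 b \<in> U_prim m n"
      using rotate_in_U_prim[OF assms(1) ab(1)] by (auto simp: cyclic_class_def)
    then have "n = h"
      using repeated_primitive_disjoint[of n n h "repeated 2 b" m b] h ab by simp
    then show False using h by simp
  qed
  then have "plus_sum m n x = S (U_prim m n) + S A"
    using True unfolding plus_sum_def U_prim_plus_classes_def U_prim_plus_def S_def
    by (auto simp: U_dprim_half image_Un A_def h_def intro!: sum.union_disjoint)
  moreover have "of_nat n * S (U_prim m n) = prim_sum m n x"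
    unfolding S_def by (rule of_nat_times_prim_class_sum[OF assms])
  moreover have "of_nat h * S A = prim_sum m h (x\<^sup>2)"
  proof -
    have "of_nat h * S A = (\<Sum>a\<in>A. x powi class_wt m (cyclic_class a))"
      unfolding S_def
    proof (rule sum_cyclic_classes)
      show "rotate j a \<in> A" if "a \<in> A" for a j
        using that rotate_in_U_prim[OF assms(1)] by (auto simp: A_def rotate_repeated)
      show "card (cyclic_class a) = h" if a: "a \<in> A" for a
      proof -
        obtain b where b: "a = repeated 2 b" "b \<in> U_prim m h" using a by (auto simp: A_def)
        have "inj_on (repeated 2) (cyclic_class b)"
          by (auto simp: inj_on_def cyclic_class_def repeated_inject)
        then have "card (cyclic_class a) = card (cyclic_class b)"
          unfolding b(1) cyclic_class_repeated by (rule card_image)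
        then show ?thesis
          using b h by (auto simp: card_cyclic_class_primitive U_prim_def U_def)
      qed
    qed (simp add: A_def)
    also have "\<dots> = (\<Sum>b\<in>U_prim m h. x powi class_wt m (cyclic_class (repeated 2 b)))"
      unfolding A_def by (simp add: sum.reindex inj_on_repeated_U_prim)
    also have "\<dots> = prim_sum m h (x\<^sup>2)"
      unfolding prim_sum_def
      by (intro sum.cong refl powi_class_wt_repeated[OF assms(1)])
    finally show ?thesis .
  qed
  ultimately show ?thesis
    using True h by (simp add: algebra_simps flip: h_def)
next
  case False
  then show ?thesis using of_nat_times_prim_class_sum[OF assms, of x]
    by (auto simp: plus_sum_def U_prim_plus_classes_def U_prim_plus_def)
qed

text \<open>
  The repeated words in the definition of \<open>U_prim_plus\<close> compensate the signs of the words of odd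
  length, as in \<open>1 + y = (1 - y\<^sup>2) / (1 - y)\<close>.
\<close>

lemma signed_plus_sum:
  fixes x :: "'a::field"
  assumes "m \<ge> 1" "N > 0"
  defines "e \<equiv> (-1) ^ (m - 1) :: 'a"
  shows "(\<Sum>n | n dvd N. e ^ n * (of_nat n * plus_sum m n (x ^ (N div n)))) = e ^ N * bridge_sum m N x"
proof -
  have pos: "n > 0" if "n dvd N" for n using that assms(2) by (auto intro!: Nat.gr0I)
  have fin: "finite {n. n dvd N}" using assms(2) by simp
  show ?thesis
  proof (cases "even m")
    case False
    then have "e = 1" by (simp add: e_def)
    then show ?thesis
      using False assms pos by (auto simp: bridge_sum_eq_prim_sum of_nat_times_plus_sum intro!: sum.cong)
  next
    case True
    then have e: "e = -1" using assms(1) by (simp add: e_def)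
    define p where "p = (\<lambda>n. prim_sum m n (x ^ (N div n)))"
    have "(\<Sum>n | n dvd N. e ^ n * (of_nat n * plus_sum m n (x ^ (N div n))))
        = (\<Sum>n | n dvd N. (-1) ^ n * p n + (if n mod 4 = 2 then 2 * p (n div 2) else 0))"
    proof (intro sum.cong refl)
      fix n assume n: "n \<in> {n. n dvd N}"
      have "(x ^ (N div n))\<^sup>2 = x ^ (N div (n div 2))" if "n mod 4 = 2"
      proof -
        define h where "h = n div 2"
        have h: "n = 2 * h" "h > 0" using that unfolding h_def by presburger+
        obtain k where "N = n * k" using n by auto
        then have "N div n = k" "N div h = k * 2" using h by simp_all
        then show ?thesis by (simp add: power_mult flip: h_def)
      qed
      moreover have "even n" if "n mod 4 = 2" using that by presburger
      ultimately show "e ^ n * (of_nat n * plus_sum m n (x ^ (N div n)))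
          = (-1) ^ n * p n + (if n mod 4 = 2 then 2 * p (n div 2) else 0)"
        using of_nat_times_plus_sum[OF assms(1) pos, of n "x ^ (N div n)"] True n
        by (auto simp: e p_def)
    qed
    also have "\<dots> = (\<Sum>n | n dvd N. (-1) ^ n * p n) + (\<Sum>n | n dvd N \<and> n mod 4 = 2. 2 * p (n div 2))"
      using fin by (simp add: sum.distrib sum.inter_filter[symmetric])
    \<comment> \<open>Halving maps the divisors congruent to 2 modulo 4 onto the odd divisors, and
      such divisors exist only for even \<open>N\<close>. Adding \<open>2 * p n\<close> then turns
      the sign \<open>-1\<close> of an odd \<open>n\<close> into
      \<open>(-1) ^ N = 1\<close>.\<close>
    also have "(\<Sum>n | n dvd N \<and> n mod 4 = 2. 2 * p (n div 2))
        = (\<Sum>n | n dvd N. if even N \<and> odd n then 2 * p n else 0)"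
    proof -
      have "(\<Sum>n | n dvd N \<and> n mod 4 = 2. 2 * p (n div 2)) = (\<Sum>n | n dvd N \<and> even N \<and> odd n. 2 * p n)"
      proof (rule sum.reindex_bij_witness[of _ "\<lambda>n. 2 * n" "\<lambda>n. n div 2"], goal_cases)
        case (1 n)
        then have "n mod 4 = 2" by simp
        then show ?case by presburger
      next
        case (2 n)
        then have n: "n mod 4 = 2" "n dvd N" by simp_all
        from n(1) have "n = 2 * (n div 2)" "odd (n div 2)" by presburger+
        then show ?case using n(2) by (metis (mono_tags, lifting) dvd_mult_left dvd_mult_right mem_Collect_eq)
      next
        case (4 n)
        then have n: "n dvd N" "even N" "odd n" by simp_all
        then have "2 * n dvd N" by (auto intro: divides_mult)
        moreover have "2 * n mod 4 = 2" using n(3) by presburger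
        ultimately show ?case by simp
      qed simp_all
      also have "\<dots> = (\<Sum>n | n dvd N. if even N \<and> odd n then 2 * p n else 0)"
        using fin by (simp add: sum.inter_filter[symmetric])
      finally show ?thesis .
    qed
    also have "(\<Sum>n | n dvd N. (-1) ^ n * p n) + (\<Sum>n | n dvd N. if even N \<and> odd n then 2 * p n else 0)
        = (\<Sum>n | n dvd N. (-1) ^ N * p n)"
      unfolding sum.distrib[symmetric]
    proof (intro sum.cong refl)
      fix n assume "n \<in> {n. n dvd N}"
      then have "even n \<Longrightarrow> even N" by auto
      then show "(-1) ^ n * p n + (if even N \<and> odd n then 2 * p n else 0) = (-1) ^ N * p n"
        by (cases "even n"; cases "even N") auto
    qed
    finally show ?thesis
      using assms by (simp add: bridge_sum_eq_prim_sum e p_def sum_distrib_left)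
  qed
qed

section \<open>Equidistribution of the class weights\<close>

lemma fps_compose_X_power_nth:
  assumes "d > 0"
  shows "(F oo fps_X ^ d) $ n = (if d dvd n then F $ (n div d) else (0::'a::comm_ring_1))"
proof -
  have "(F oo fps_X ^ d) $ n = (\<Sum>i=0..n. if n = d * i then F $ i else 0)"
    unfolding fps_compose_nth power_mult [symmetric] by (intro sum.cong) auto
  also have "\<dots> = (if d dvd n then F $ (n div d) else 0)"
  proof (cases "d dvd n")
    case True
    then obtain k where k: "n = d * k" by auto
    then have "k \<le> n" using assms by simp
    have "(\<Sum>i=0..n. if n = d * i then F $ i else 0) = (\<Sum>i\<in>{k}. F $ i)"
      using assms k \<open>k \<le> n\<close> by (intro sum.mono_neutral_cong_right) auto
    then show ?thesis using k assms by simp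
  next
    case False
    then have "n \<noteq> d * i" for i by auto
    then show ?thesis using False by simp
  qed
  finally show ?thesis .
qed

lemma log_deriv_compose_X_power:
  fixes F :: "'a::field fps"
  assumes "F $ 0 \<noteq> 0" "d > 0"
  shows "log_deriv (F oo fps_X ^ d) = fps_const (of_nat d) * (log_deriv F oo fps_X ^ d)"
proof -
  have "fps_XD (F oo fps_X ^ d) = fps_const (of_nat d) * (fps_XD F oo fps_X ^ d)"
    using assms by (intro fps_ext) (auto simp: fps_compose_X_power_nth simp flip: of_nat_mult)
  also have "fps_XD F oo fps_X ^ d = (F oo fps_X ^ d) * (log_deriv F oo fps_X ^ d)"
    using assms by (simp add: XD_eq_log_deriv fps_compose_mult_distrib)
  finally show ?thesis
    using assms by (subst log_deriv_eq_iff) (simp_all add: mult_ac)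
qed

section \<open>Evaluation of the bridge sums at roots of unity\<close>

definition geom :: "'a::comm_ring_1 \<Rightarrow> 'a fps" where
  "geom x = Abs_fps (\<lambda>k. x ^ k)"

lemma geom_0 [simp]: "geom x $ 0 = 1"
  by (simp add: geom_def)

text \<open>The right-hand side is the complete homogeneous symmetric polynomial of degree
  \<open>k\<close> in \<open>xs\<close>; words serve as the exponent vectors of its
  monomials.\<close>

lemma prod_list_geom_nth:
  "(\<Prod>x\<leftarrow>xs. geom x) $ k
    = (\<Sum>a | length a = length xs \<and> sum_list a = k. \<Prod>i<length xs. xs ! i ^ a ! i)"
proof (induction xs arbitrary: k)
  case Nil
  have "{a :: nat list. length a = length ([] :: 'a list) \<and> sum_list a = k} = (if k = 0 then {[]} else {})"
    by auto
  then show ?case by simp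
next
  case (Cons x xs)
  define W where "W = (\<lambda>k. {a :: nat list. length a = length xs \<and> sum_list a = k})"
  define f where "f = (\<lambda>a. \<Prod>i<length xs. xs ! i ^ a ! i)"
  have fin: "finite (W j)" for j
  proof (rule finite_subset)
    show "W j \<subseteq> {a. set a \<subseteq> {..j} \<and> length a = length xs}"
      by (auto simp: W_def dest: member_le_sum_list)
  qed (simp add: finite_lists_length_eq)
  have "(\<Prod>x\<leftarrow>x # xs. geom x) $ k = (\<Sum>j=0..k. x ^ j * (\<Sum>a\<in>W (k - j). f a))"
    by (simp add: fps_mult_nth Cons.IH W_def f_def) (simp add: geom_def)
  also have "\<dots> = (\<Sum>(j,a)\<in>Sigma {0..k} (\<lambda>j. W (k - j)). x ^ j * f a)"
    unfolding sum_distrib_left by (subst sum.Sigma) (auto simp: fin)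
  also have "\<dots> = (\<Sum>a | length a = length (x # xs) \<and> sum_list a = k.
      \<Prod>i<length (x # xs). (x # xs) ! i ^ a ! i)"
  proof (rule sum.reindex_bij_witness[of _ "\<lambda>a. (hd a, tl a)" "\<lambda>(j,a). j # a"], goal_cases)
    case (4 a)
    then show ?case by (cases a) (auto simp: W_def)
  next
    case (3 a)
    then show ?case by (cases a) auto
  next
    case (5 z)
    then show ?case by (auto simp: f_def prod.lessThan_Suc_shift simp del: prod.lessThan_Suc)
  qed (auto simp: W_def)
  finally show ?case .
qed

lemma prod_list_geom:
  fixes xs :: "'a::field list"
  shows "log_deriv (\<Prod>x\<leftarrow>xs. geom x) = (\<Sum>x\<leftarrow>xs. log_deriv (geom x))" "(\<Prod>x\<leftarrow>xs. geom x) $ 0 = 1"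
  using log_deriv_prod_list[of xs geom] by auto

text \<open>A constant minus a linear form in the entries, so that a power with exponent
  \<open>wt m a\<close> factors over the positions of the word.\<close>

lemma wt_eq_diff:
  assumes "m \<ge> 1"
  shows "wt m a = int ((m - 1) * (\<Sum>i<length a. i)) - int (\<Sum>i<length a. (length a - Suc i) * a ! i)"
proof -
  define N where "N = length a"
  have "wt m a = (\<Sum>i<N. int (N - Suc i) * (int (m - 1) - int (a ! i)))"
    unfolding wt_def N_def[symmetric]
    by (rule sum.reindex_bij_witness[of _ Suc "\<lambda>i. i - 1"]) (use assms in \<open>auto simp: of_nat_diff\<close>)
  also have "\<dots> = int (m - 1) * (\<Sum>i<N. int (N - Suc i)) - (\<Sum>i<N. int (N - Suc i) * int (a ! i))"
    by (simp add: right_diff_distrib sum_subtractf sum_distrib_left mult.commute)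
  also have "(\<Sum>i<N. int (N - Suc i)) = (\<Sum>i<N. int i)"
    by (rule sum.nat_diff_reindex)
  finally show ?thesis by (simp add: N_def)
qed

text \<open>The product of \<open>1 / (1 - z ^ (- j) t)\<close> over \<open>j < N\<close>. If
  \<open>z\<close> has order \<open>d\<close> dividing \<open>N\<close>, it equals
  \<open>(1 - t ^ d) ^ (- N / d)\<close>.\<close>

definition root_prod :: "nat \<Rightarrow> 'a::field \<Rightarrow> 'a fps" where
  "root_prod N z = (\<Prod>x\<leftarrow>map (\<lambda>i. inverse z ^ (N - Suc i)) [0..<N]. geom x)"

text \<open>At an \<open>n\<close>-th root of unity only the weight modulo \<open>n\<close> matters,
  and this is constant on a class. The maximum thus disappears from the sum.\<close>

lemma powi_class_wt_root:
  fixes z :: "'a::field"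
  assumes "m \<ge> 1" "a \<in> U m n" "z ^ n = 1" "n > 0"
  shows "z powi class_wt m (cyclic_class a) = z powi wt m a"
proof -
  have "z \<noteq> 0" using assms by (auto simp: power_0_left)
  have "int n dvd class_wt m (cyclic_class a) - wt m a"
    using class_wt_cong[OF assms(1,2)] by (simp add: cong_iff_dvd_diff)
  then obtain k where "class_wt m (cyclic_class a) = wt m a + int n * k"
    by (metis add.commute diff_add_cancel dvdE)
  then show ?thesis using \<open>z \<noteq> 0\<close> assms by (simp add: power_int_add power_int_mult)
qed

lemma bridge_sum_root:
  fixes z :: "'a::field"
  assumes "m \<ge> 1" "N > 0" "z ^ N = 1"
  shows "bridge_sum m N z = z ^ ((m - 1) * (\<Sum>i<N. i)) * root_prod N z $ ((m - 1) * N)"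
proof -
  have z: "z \<noteq> 0" using assms by (auto simp: power_0_left)
  define xs where "xs = map (\<lambda>i. inverse z ^ (N - Suc i)) [0..<N]"
  have "bridge_sum m N z = (\<Sum>a\<in>U m N. z ^ ((m - 1) * (\<Sum>i<N. i)) * (\<Prod>i<N. xs ! i ^ a ! i))"
    unfolding bridge_sum_def
  proof (intro sum.cong refl)
    fix a assume a: "a \<in> U m N"
    then have "length a = N" by (simp add: length_U)
    have "z powi class_wt m (cyclic_class a) = z powi wt m a"
      by (rule powi_class_wt_root[OF assms(1) a assms(3,2)])
    also have "\<dots> = z ^ ((m - 1) * (\<Sum>i<N. i)) * inverse z ^ (\<Sum>i<N. (N - Suc i) * a ! i)"
      unfolding wt_eq_diff[OF assms(1)] \<open>length a = N\<close>
      by (subst power_int_diff) (auto simp: z power_inverse divide_inverse simp del: of_nat_sum of_nat_mult)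
    also have "inverse z ^ (\<Sum>i<N. (N - Suc i) * a ! i) = (\<Prod>i<N. xs ! i ^ a ! i)"
      by (simp add: power_sum power_mult xs_def)
    finally show "z powi class_wt m (cyclic_class a)
        = z ^ ((m - 1) * (\<Sum>i<N. i)) * (\<Prod>i<N. xs ! i ^ a ! i)" .
  qed
  also have "\<dots> = z ^ ((m - 1) * (\<Sum>i<N. i)) * root_prod N z $ ((m - 1) * N)"
    unfolding root_prod_def xs_def[symmetric] prod_list_geom_nth
    by (simp add: sum_distrib_left U_def xs_def)
  finally show ?thesis .
qed

lemma root_prod_0 [simp]: "root_prod N z $ 0 = 1"
  unfolding root_prod_def by (rule prod_list_geom)

text \<open>Coefficient \<open>k\<close> is the \<open>k\<close>-th power sum of the factors'
  parameters, a geometric sum with ratio \<open>u = z ^ (- k)\<close>. Since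
  \<open>u ^ N = 1\<close>, it vanishes unless \<open>u = 1\<close>.\<close>

lemma log_deriv_root_prod:
  fixes z :: "'a::field"
  assumes "z ^ N = 1"
  shows "log_deriv (root_prod N z) $ k = (if k > 0 \<and> z ^ k = 1 then of_nat N else 0)"
proof (cases "k = 0")
  case False
  define u where "u = inverse z ^ k"
  have "log_deriv (root_prod N z) $ k = (\<Sum>x\<leftarrow>map (\<lambda>i. inverse z ^ (N - Suc i)) [0..<N]. log_deriv (geom x)) $ k"
    unfolding root_prod_def prod_list_geom ..
  also have "\<dots> = (\<Sum>x\<leftarrow>map (\<lambda>i. inverse z ^ (N - Suc i)) [0..<N]. x ^ k)"
  proof -
    have "(\<Sum>x\<leftarrow>xs. log_deriv (geom x)) $ k = (\<Sum>x\<leftarrow>xs. x ^ k)" for xs :: "'a list"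
      using False by (induction xs) (simp_all add: geom_def log_deriv_geometric)
    then show ?thesis .
  qed
  also have "\<dots> = (\<Sum>i<N. u ^ (N - Suc i))"
    by (simp add: interv_sum_list_conv_sum_set_nat atLeast0LessThan u_def comp_def mult.commute flip: power_mult)
  also have "\<dots> = (\<Sum>i<N. u ^ i)" by (rule sum.nat_diff_reindex)
  also have "\<dots> = (if z ^ k = 1 then of_nat N else 0)"
  proof (cases "u = 1")
    case True
    then show ?thesis by (simp add: u_def power_inverse)
  next
    case False
    have "u ^ N = 1" using assms
      by (metis mult.commute power_inverse inverse_1 power_mult power_one u_def)
    then have "(\<Sum>i<N. u ^ i) = 0" using False by (simp add: geometric_sum)
    then show ?thesis using False by (simp add: u_def power_inverse)
  qed
  finally show ?thesis using False by simp
qed simp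

lemma exists_root_order:
  fixes z :: "'a::field"
  assumes "z ^ N = 1" "N > 0"
  obtains d where "d > 0" "\<And>k. z ^ k = 1 \<longleftrightarrow> d dvd k"
proof -
  define d where "d = (LEAST d. 0 < d \<and> z ^ d = 1)"
  have d: "0 < d \<and> z ^ d = 1"
    unfolding d_def by (rule LeastI[of _ N]) (use assms in simp)
  have "z ^ k = 1 \<longleftrightarrow> d dvd k" for k
  proof
    assume k: "z ^ k = 1"
    have "z ^ k = (z ^ d) ^ (k div d) * z ^ (k mod d)"
      by (simp flip: power_mult power_add)
    then have "z ^ (k mod d) = 1" using d k by simp
    moreover have "k mod d < d" using d by simp
    ultimately have "\<not> 0 < k mod d"
      using not_less_Least[of "k mod d" "\<lambda>d. 0 < d \<and> z ^ d = 1", folded d_def] by simp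
    then show "d dvd k" by auto
  qed (use d in \<open>auto elim!: dvdE simp: power_mult\<close>)
  with d that show ?thesis by blast
qed

text \<open>With \<open>r = N div d\<close>, comparing logarithmic derivatives identifies
  \<open>root_prod N z\<close> with \<open>root_prod r 1\<close> at \<open>t ^ d\<close>. What
  remains is the power of \<open>z\<close> with exponent \<open>(m - 1) * N * (N - 1) / 2\<close>,
  which is a sign and is absorbed by the signs on both sides.\<close>

lemma bridge_sum_root_order:
  fixes z :: "'a::field_char_0"
  assumes "m \<ge> 1" "N > 0" "d > 0" and d: "\<And>k. z ^ k = 1 \<longleftrightarrow> d dvd k" and dN: "d dvd N"
  shows "(-1) ^ ((m - 1) * N) * bridge_sum m N z = (-1) ^ ((m - 1) * (N div d)) * bridge_sum m (N div d) 1"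
proof -
  have zN: "z ^ N = 1" using d dN by simp
  obtain r where r: "N = d * r" using dN by auto
  then have "r > 0" "N div d = r" using assms by auto
  have "root_prod N z = root_prod r 1 oo fps_X ^ d"
  proof (rule log_deriv_inject)
    show "(root_prod r 1 oo fps_X ^ d) $ 0 = (1::'a)"
      using \<open>d > 0\<close> by (simp add: fps_compose_X_power_nth)
    show "log_deriv (root_prod N z) = log_deriv (root_prod r 1 oo fps_X ^ d)"
    proof (rule fps_ext)
      fix k
      show "log_deriv (root_prod N z) $ k = log_deriv (root_prod r 1 oo fps_X ^ d) $ k"
      proof (cases "d dvd k")
        case True
        then have "k > 0 \<longleftrightarrow> k div d > 0" using \<open>d > 0\<close> by (auto elim!: dvdE)
        then show ?thesis using \<open>d > 0\<close> zN True
          by (simp add: log_deriv_compose_X_power fps_compose_X_power_nth log_deriv_root_prod d r)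
      qed (use \<open>d > 0\<close> zN in \<open>simp add: log_deriv_compose_X_power fps_compose_X_power_nth log_deriv_root_prod d\<close>)
    qed
  qed simp
  then have "root_prod N z $ ((m - 1) * N) = root_prod r 1 $ ((m - 1) * r)"
    using \<open>d > 0\<close> by (simp add: fps_compose_X_power_nth r mult.left_commute)
  moreover have "bridge_sum m r (1::'a) = root_prod r 1 $ ((m - 1) * r)"
    using bridge_sum_root[OF assms(1) \<open>r > 0\<close>, of "1::'a"] by simp
  ultimately have B: "bridge_sum m N z = z ^ ((m - 1) * (\<Sum>i<N. i)) * bridge_sum m r 1"
    using bridge_sum_root[OF assms(1,2) zN] by simp
  have gauss: "2 * (\<Sum>i<N. i) = N * (N - 1)"
  proof (induction N)
    case (Suc N)
    then show ?case by (cases N) (auto simp: algebra_simps)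
  qed simp
  have "(-1) ^ ((m - 1) * N) * z ^ ((m - 1) * (\<Sum>i<N. i)) = ((-1) ^ ((m - 1) * r) :: 'a)"
  proof (cases "even (m - 1)")
    case True
    then obtain c where c: "m - 1 = 2 * c" by (rule evenE)
    have "(m - 1) * (\<Sum>i<N. i) = N * (c * (N - 1))"
      unfolding c using gauss by (simp add: algebra_simps)
    then have "z ^ ((m - 1) * (\<Sum>i<N. i)) = 1" by (simp add: power_mult zN)
    then show ?thesis using True by simp
  next
    case odd: False
    show ?thesis
    proof (cases "even N")
      case True
      then obtain h where h: "N = 2 * h" by auto
      have "(\<Sum>i<N. i) = h * (N - 1)" using gauss h by simp
      then have "z ^ ((m - 1) * (\<Sum>i<N. i)) = (z ^ h) ^ ((m - 1) * (N - 1))"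
        by (simp add: mult_ac flip: power_mult)
      moreover have "odd ((m - 1) * (N - 1))" using odd True assms(2) by simp
      \<comment> \<open>\<open>z ^ h\<close> is a square root of \<open>z ^ N = 1\<close>, and it
        equals 1 exactly when \<open>d\<close> divides \<open>h = N / 2\<close>, that is, when
        \<open>r\<close> is even.\<close>
      moreover have "z ^ h = (-1) ^ r"
      proof (cases "even r")
        case True
        then have "d dvd h" using r h by (auto elim!: evenE)
        then show ?thesis using True d by simp
      next
        case False
        have "\<not> d dvd h"
        proof
          assume "d dvd h"
          then obtain k where "h = d * k" by auto
          then have "r = 2 * k" using r h \<open>d > 0\<close> by simp
          then show False using False by simp
        qed
        then have "z ^ h \<noteq> 1" using d by simp
        moreover have "(z ^ h)\<^sup>2 = 1" using zN by (simp add: h mult.commute flip: power_mult)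
        ultimately show ?thesis using False by (simp add: power2_eq_1_iff)
      qed
      ultimately have "z ^ ((m - 1) * (\<Sum>i<N. i)) = (-1) ^ r"
        by (cases "even r") auto
      then show ?thesis using odd True by (simp add: power_mult)
    next
      case False
      then have "even (N - 1)" by simp
      then obtain c where "N - 1 = 2 * c" by (rule evenE)
      then have "(\<Sum>i<N. i) = N * c" using gauss by simp
      then have "z ^ ((m - 1) * (\<Sum>i<N. i)) = (z ^ N) ^ ((m - 1) * c)"
        by (simp add: mult_ac flip: power_mult)
      then have "z ^ ((m - 1) * (\<Sum>i<N. i)) = 1" by (simp add: zN)
      moreover have "odd r" using False r by simp
      ultimately show ?thesis using odd False by (simp add: power_mult)
    qed
  qed
  then show ?thesis
    unfolding B \<open>N div d = r\<close> by (simp add: mult.assoc[symmetric])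
qed

text \<open>Strong induction on \<open>N\<close>. If \<open>z\<close> has order \<open>d\<close>,
  the signed divisor sum for \<open>N\<close> at \<open>z\<close> equals the one for
  \<open>N div d\<close> at 1. The divisors \<open>n\<close> of \<open>N div d\<close> are the
  proper divisors of \<open>N\<close> with \<open>z ^ (N div n) = 1\<close>, so their terms agree;
  the other proper divisors contribute 0 by induction. Only the term \<open>n = N\<close> is left,
  and it must vanish.\<close>

lemma plus_sum_root_of_unity:
  fixes z :: "'a::field_char_0"
  assumes "m \<ge> 1" "N > 0" "z ^ N = 1" "z \<noteq> 1"
  shows "plus_sum m N z = 0"
  using assms(2-4)
proof (induction N arbitrary: z rule: less_induct)
  case (less N)
  define e where "e = ((-1) ^ (m - 1) :: 'a)"
  obtain d where d: "d > 0" "\<And>k. z ^ k = 1 \<longleftrightarrow> d dvd k"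
    using exists_root_order[OF less.prems(2,1)] by blast
  have dN: "d dvd N" using d less.prems by simp
  have "d \<noteq> 1" using d(2)[of 1] less.prems by auto
  define f where "f = (\<lambda>n x. e ^ n * (of_nat n * plus_sum m n x))"
  have fin: "finite {n. n dvd N}" using less.prems by simp
  have "(\<Sum>n | n dvd N. f n (z ^ (N div n))) = e ^ N * bridge_sum m N z"
    unfolding f_def e_def by (rule signed_plus_sum[OF assms(1) less.prems(1)])
  also have "\<dots> = e ^ (N div d) * bridge_sum m (N div d) 1"
    using bridge_sum_root_order[OF assms(1) less.prems(1) d dN] by (simp add: e_def power_mult)
  also have "\<dots> = (\<Sum>n | n dvd N div d. f n 1)"
  proof -
    have "N div d > 0" using dN less.prems(1) by (auto elim!: dvdE)
    from signed_plus_sum[OF assms(1) this, of "1::'a"] show ?thesis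
      by (simp add: f_def e_def)
  qed
  finally have eq: "(\<Sum>n | n dvd N. f n (z ^ (N div n))) = (\<Sum>n | n dvd N div d. f n 1)" .
  have sub: "n dvd N div d \<longleftrightarrow> n dvd N \<and> n \<noteq> N \<and> z ^ (N div n) = 1" for n
  proof -
    have "d dvd N div n \<longleftrightarrow> n dvd N div d" if "n dvd N"
    proof -
      have "n \<noteq> 0" using that less.prems by auto
      then show ?thesis
        using that dN d(1) by (simp add: dvd_div_iff_mult mult.commute)
    qed
    moreover have "n dvd N" if "n dvd N div d" 
    proof -
      have "n dvd N div d * d" using that by simp
      then show ?thesis using dN by simp
    qed
    moreover have "n \<noteq> N" if "n dvd N div d"
    proof
      assume "n = N"
      moreover have "N div d > 0" using dN d(1) less.prems by (auto elim!: dvdE)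
      moreover have "N div d < N" using \<open>d \<noteq> 1\<close> d(1) less.prems by simp
      ultimately show False using that by (auto dest: dvd_imp_le)
    qed
    ultimately show ?thesis using d(2) by blast
  qed
  have "(\<Sum>n | n dvd N. f n (z ^ (N div n))) = f N z + (\<Sum>n\<in>{n. n dvd N} - {N}. f n (z ^ (N div n)))"
    using fin less.prems by (subst sum.remove[of _ N]) auto
  also have "(\<Sum>n\<in>{n. n dvd N} - {N}. f n (z ^ (N div n))) = (\<Sum>n | n dvd N div d. f n 1)"
  proof (intro sum.mono_neutral_cong_right)
    show "\<forall>n\<in>{n. n dvd N} - {N} - {n. n dvd N div d}. f n (z ^ (N div n)) = 0"
    proof
      fix n assume n: "n \<in> {n. n dvd N} - {N} - {n. n dvd N div d}"
      then have n': "n dvd N" "n < N" "n > 0" using less.prems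
        by (auto intro!: Nat.gr0I le_neq_implies_less dvd_imp_le)
      moreover have "z ^ (N div n) \<noteq> 1" using n sub by blast
      moreover have "(z ^ (N div n)) ^ n = 1"
        using n' less.prems by (simp flip: power_mult)
      ultimately show "f n (z ^ (N div n)) = 0" by (simp add: f_def less.IH)
    qed
  qed (use fin sub in auto)
  finally have "f N z = 0" using eq by simp
  then show ?case using less.prems by (auto simp: f_def e_def)
qed

section \<open>Counting class weights by residue\<close>

lemma finite_U_prim_plus_classes [simp]: "finite (U_prim_plus_classes m n)"
proof -
  have "finite (U_dprim m n d)" for d by (simp add: U_dprim_def)
  then show ?thesis by (simp add: U_prim_plus_classes_def U_prim_plus_def)
qed

lemma plus_sum_1: "plus_sum m n 1 = of_nat (card (U_prim_plus_classes m n))"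
  by (simp add: plus_sum_def)

text \<open>Fourier inversion on the integers modulo \<open>n\<close>: summing
  \<open>w ^ (- i j)\<close> times the class sum at \<open>w ^ j\<close> over all \<open>j\<close>
  selects the residue \<open>i\<close>. By the vanishing at nontrivial roots only
  \<open>j = 0\<close> contributes, and its term is the same for every \<open>i\<close>.\<close>

lemma class_wt_equidistributed:
  assumes "m \<ge> 1" "n > 0" "i < n"
  shows "n * card {C \<in> U_prim_plus_classes m n. [class_wt m C = int i] (mod int n)}
    = card (U_prim_plus_classes m n)"
proof -
  define w :: complex where "w = cis (2 * pi / real n)"
  define Cs where "Cs = U_prim_plus_classes m n"
  have w0: "w \<noteq> 0" by (simp add: w_def)
  have wn: "w ^ n = 1" using assms by (simp add: w_def DeMoivre)
  have w_inj: "w ^ j \<noteq> 1" if "0 < j" "j < n" for j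
  proof
    assume "w ^ j = 1"
    then have "cis (2 * pi * real j / real n) = cis (2 * pi * real 0 / real n)"
      by (simp add: w_def DeMoivre mult_ac)
    moreover have "inj_on (\<lambda>k. cis (2 * pi * real k / real n)) {..<n}"
      using bij_betw_roots_unity[OF assms(2)] by (rule bij_betw_imp_inj_on)
    moreover have "j \<in> {..<n}" "0 \<in> {..<n}" using that assms(2) by auto
    ultimately have "j = 0" by (metis (no_types, lifting) inj_onD)
    then show False using that by simp
  qed
  have "of_nat (card Cs) = (\<Sum>j<n. inverse w ^ (i * j) * plus_sum m n (w ^ j))"
  proof -
    have "(\<Sum>j<n. inverse w ^ (i * j) * plus_sum m n (w ^ j)) = (\<Sum>j\<in>{0::nat}. plus_sum m n 1)"
    proof (rule sum.mono_neutral_cong_right)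
      show "\<forall>j\<in>{..<n} - {0}. inverse w ^ (i * j) * plus_sum m n (w ^ j) = 0"
      proof
        fix j assume j: "j \<in> {..<n} - {0}"
        have "(w ^ j) ^ n = 1" using wn by (metis mult.commute power_mult power_one)
        then have "plus_sum m n (w ^ j) = 0"
          using j w_inj[of j] assms by (intro plus_sum_root_of_unity) auto
        then show "inverse w ^ (i * j) * plus_sum m n (w ^ j) = 0" by simp
      qed
    qed (use assms in auto)
    then show ?thesis by (simp add: plus_sum_1 Cs_def)
  qed
  also have "\<dots> = (\<Sum>C\<in>Cs. \<Sum>j<n. (w powi (class_wt m C - int i)) ^ j)"
  proof -
    have "inverse w ^ (i * j) * ((w ^ j) powi k) = (w powi (k - int i)) ^ j" for j k
    proof -
      have "(w powi (k - int i)) ^ j = (w powi k) ^ j / (w ^ i) ^ j"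
        by (simp add: power_int_diff w0 power_divide)
      also have "(w powi k) ^ j = (w ^ j) powi k"
        by (simp add: power_int_power power_int_power' mult.commute)
      finally show ?thesis by (simp add: power_inverse divide_inverse power_mult mult.commute)
    qed
    then show ?thesis
      unfolding plus_sum_def Cs_def[symmetric] sum_distrib_left by (subst sum.swap) simp
  qed
  also have "\<dots> = (\<Sum>C\<in>Cs. if [class_wt m C = int i] (mod int n) then of_nat n else 0)"
  proof (intro sum.cong refl)
    fix C
    define k where "k = class_wt m C - int i"
    have "w powi k = 1 \<longleftrightarrow> int n dvd k"
    proof -
      have "k = int n * (k div int n) + int (nat (k mod int n))"
        using assms by simp
      then have "w powi k = w powi (int n * (k div int n) + int (nat (k mod int n)))"
        by (rule arg_cong)
      also have "\<dots> = w ^ nat (k mod int n)"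
        by (subst power_int_add) (simp_all add: w0 power_int_mult wn del: int_nat_eq)
      finally have *: "w powi k = w ^ nat (k mod int n)" .
      have "nat (k mod int n) < n" using assms by (simp add: nat_less_iff)
      then have "w ^ nat (k mod int n) = 1 \<longleftrightarrow> nat (k mod int n) = 0"
        using w_inj[of "nat (k mod int n)"] by (metis neq0_conv power_0)
      moreover have "nat (k mod int n) = 0 \<longleftrightarrow> int n dvd k"
      proof -
        have "0 \<le> k mod int n" using assms by simp
        then have "nat (k mod int n) = 0 \<longleftrightarrow> k mod int n = 0" by linarith
        then show ?thesis unfolding dvd_eq_mod_eq_0 .
      qed
      ultimately show ?thesis using * by simp
    qed
    moreover have "(\<Sum>j<n. (w powi k) ^ j) = 0" if "w powi k \<noteq> 1"
    proof -
      have "(w powi k) ^ n = w powi (int n * k)" by (simp add: power_int_power' mult.commute)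
      also have "\<dots> = 1" by (simp add: power_int_mult wn)
      finally have "(w powi k) ^ n = 1" .
      then show ?thesis using that by (simp add: geometric_sum)
    qed
    ultimately show "(\<Sum>j<n. (w powi (class_wt m C - int i)) ^ j)
        = (if [class_wt m C = int i] (mod int n) then of_nat n else 0)"
      unfolding cong_iff_dvd_diff k_def[symmetric] by auto
  qed
  also have "\<dots> = of_nat (n * card {C\<in>Cs. [class_wt m C = int i] (mod int n)})"
    by (simp add: Cs_def sum.inter_filter[symmetric])
  finally have "(of_nat (n * card {C\<in>Cs. [class_wt m C = int i] (mod int n)}) :: complex) = of_nat (card Cs)"
    by simp
  then show ?thesis unfolding of_nat_eq_iff Cs_def .
qed

section \<open>The functional equations\<close>

text \<open>Nonnegative paths from height \<open>s\<close> down to 0, with \<open>M = m - 1\<close>.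
  The bound on \<open>a\<close> keeps the subtraction of naturals exact, so structural recursion
  follows the first step.\<close>

fun path_from :: "nat \<Rightarrow> nat \<Rightarrow> nat list \<Rightarrow> bool" where
  "path_from M s [] \<longleftrightarrow> s = 0"
| "path_from M s (a # as) \<longleftrightarrow> a \<le> s + M \<and> path_from M (s + M - a) as"

fun path_area :: "nat \<Rightarrow> nat \<Rightarrow> nat list \<Rightarrow> nat" where
  "path_area M s [] = 0"
| "path_area M s (a # as) = s + path_area M (s + M - a) as"

lemma height_Cons:
  "k \<le> length as \<Longrightarrow> height m (a # as) (Suc k) = int m - 1 - int a + height m as k"
  using height_append2[of k as m "[a]"] by (simp add: height_Suc)

lemma wt_Cons: "wt m (a # as) = int (length as) * (int m - 1 - int a) + wt m as"
proof -
  have "wt m (a # as) = (\<Sum>k<length as. height m (a # as) (Suc k))"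
    by (simp add: wt_eq_sum_height sum.lessThan_Suc_shift del: sum.lessThan_Suc)
  also have "\<dots> = (\<Sum>k<length as. int m - 1 - int a + height m as k)"
    by (intro sum.cong) (auto simp: height_Cons)
  finally show ?thesis by (simp add: sum.distrib wt_eq_sum_height)
qed

lemma path_from_iff:
  assumes "m \<ge> 1"
  shows "path_from (m - 1) s a \<longleftrightarrow>
    (\<forall>k\<le>length a. int s + height m a k \<ge> 0) \<and> int s + height m a (length a) = 0"
proof (induction a arbitrary: s)
  case (Cons b a)
  have all: "(\<forall>k\<le>Suc n. P k) \<longleftrightarrow> P 0 \<and> (\<forall>k\<le>n. P (Suc k))" for P and n :: nat
    by (metis Suc_le_mono not0_implies_Suc zero_le)
  show ?case
  proof (cases "b \<le> s + (m - 1)")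
    case True
    then have *: "int (s + (m - 1) - b) = int s + (int m - 1 - int b)"
      using assms by simp
    show ?thesis
      using True Cons.IH[of "s + (m - 1) - b"] unfolding *
      by (simp add: all height_Cons add.assoc del: One_nat_def)
  next
    case False
    then have "int s + (int m - 1 - int b) < 0" using assms by simp
    then have "int s + height m (b # a) (Suc 0) < 0" by (simp add: height_Cons)
    then show ?thesis using False by (auto simp: all)
  qed
qed auto

lemma path_area_eq:
  assumes "m \<ge> 1" "path_from (m - 1) s a"
  shows "int (path_area (m - 1) s a) = int (length a) * int s + wt m a"
  using assms(2)
proof (induction a arbitrary: s)
  case Nil
  then show ?case by (simp add: wt_def)
next
  case (Cons b a)
  then have b: "b \<le> s + (m - 1)" "path_from (m - 1) (s + (m - 1) - b) a" by auto
  then have "int (s + (m - 1) - b) = int s + (int m - 1 - int b)" using assms(1) by simp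
  then show ?case using Cons.IH[OF b(2)] by (simp add: wt_Cons algebra_simps)
qed

lemma Dyck_eq: "m \<ge> 1 \<Longrightarrow> Dyck m n = {a. length a = n \<and> path_from (m - 1) 0 a}"
  by (auto simp: Dyck_def U_iff path_from_iff simp del: One_nat_def)

lemma finite_paths: "finite {a. length a = n \<and> path_from M s a}"
proof (induction n arbitrary: s)
  case (Suc n)
  have "{a. length a = Suc n \<and> path_from M s a}
      \<subseteq> (\<Union>b\<le>s + M. (#) b ` {a. length a = n \<and> path_from M (s + M - b) a})"
    by (auto simp: length_Suc_conv)
  then show ?case by (rule finite_subset) (auto simp: Suc)
qed (auto intro: finite_subset[of _ "{[]}"])

definition path_sum :: "'a::comm_semiring_1 \<Rightarrow> nat \<Rightarrow> nat \<Rightarrow> nat \<Rightarrow> 'a" where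
  "path_sum x M n s = (\<Sum>a | length a = n \<and> path_from M s a. x ^ path_area M s a)"

lemma path_sum_0: "path_sum x M 0 s = (if s = 0 then 1 else 0)"
proof -
  have "{a. length a = 0 \<and> path_from M s a} = (if s = 0 then {[]} else {})" by auto
  then show ?thesis by (simp add: path_sum_def)
qed

text \<open>The first step contributes the area \<open>s\<close> and leads to an arbitrary height
  \<open>s'\<close> up to \<open>s + M\<close>; the letter is recovered as
  \<open>s + M - s'\<close>.\<close>

lemma path_sum_Suc: "path_sum x M (Suc n) s = x ^ s * (\<Sum>s'\<le>s + M. path_sum x M n s')"
proof -
  have "x ^ s * (\<Sum>s'\<le>s + M. path_sum x M n s')
      = (\<Sum>(s',a)\<in>Sigma {..s + M} (\<lambda>s'. {a. length a = n \<and> path_from M s' a}). x ^ (s + path_area M s' a))"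
    unfolding path_sum_def sum_distrib_left power_add
    by (subst sum.Sigma) (auto simp: finite_paths)
  also have "\<dots> = path_sum x M (Suc n) s"
    unfolding path_sum_def
    by (rule sum.reindex_bij_witness[of _ "\<lambda>a. (s + M - hd a, tl a)" "\<lambda>(s',a). (s + M - s') # a"])
       (auto simp: length_Suc_conv)
  finally show ?thesis ..
qed

text \<open>
  Summing over all starting heights up to \<open>s\<close> turns the first-step recursion into a first-order
  difference equation in \<open>s\<close>, which is solved by \<open>H(q\<^sup>s t) / H(q\<^sup>-\<^sup>1 t)\<close> and, at \<open>q = 1\<close>, by \<open>F(t)\<^sup>s\<^sup>+\<^sup>1\<close>.
\<close>

lemma path_sum_unique:
  fixes V :: "nat \<Rightarrow> 'a::comm_ring_1 fps"
  assumes V: "\<And>s. V s = 1 + fps_X * (\<Sum>i\<le>s. fps_const (x ^ i) * V (i + M))"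
  shows "V s $ n = (\<Sum>i\<le>s. path_sum x M n i)"
proof (induction n arbitrary: s)
  case 0
  show ?case by (subst V) (simp add: path_sum_0)
next
  case (Suc n)
  show ?case
    by (subst V) (simp add: fps_sum_nth Suc path_sum_Suc)
qed

lemma Dyck_sum_unique:
  fixes V :: "nat \<Rightarrow> 'a::field fps"
  assumes "m \<ge> 1" and V: "\<And>s. V s = 1 + fps_X * (\<Sum>i\<le>s. fps_const (x ^ i) * V (i + (m - 1)))"
  shows "V 0 = Abs_fps (\<lambda>n. Dyck_sum m n x)"
proof (rule fps_ext)
  fix n
  have "Dyck_sum m n x = path_sum x (m - 1) n 0"
    unfolding Dyck_sum_def path_sum_def Dyck_eq[OF assms(1)]
  proof (intro sum.cong refl)
    fix a assume "a \<in> {a. length a = n \<and> path_from (m - 1) 0 a}"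
    then have "int (path_area (m - 1) 0 a) = wt m a" using path_area_eq[OF assms(1), of 0 a] by simp
    then show "x powi wt m a = x ^ path_area (m - 1) 0 a" by (metis power_int_of_nat)
  qed
  then show "V 0 $ n = Abs_fps (\<lambda>n. Dyck_sum m n x) $ n"
    using path_sum_unique[of V x "m - 1" 0 n, OF V] by simp
qed

text \<open>The constant term is set to 0, as in any logarithmic derivative; the empty word would
  contribute 1.\<close>

definition bridge_fps :: "nat \<Rightarrow> 'a::field \<Rightarrow> 'a fps" where
  "bridge_fps m x = Abs_fps (\<lambda>n. if n = 0 then 0 else bridge_sum m n x)"

lemma Dyck_sum_0: "m \<ge> 1 \<Longrightarrow> Dyck_sum m 0 x = 1"
proof -
  assume "m \<ge> 1"
  then have "Dyck m 0 = {[]}" by (auto simp: Dyck_eq)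
  then show ?thesis by (simp add: Dyck_sum_def wt_def)
qed

lemma log_deriv_Dyck:
  fixes x :: "'a::field"
  assumes "m \<ge> 1" "x \<noteq> 0"
  shows "log_deriv (Abs_fps (\<lambda>n. Dyck_sum m n x)) = bridge_fps m x"
proof -
  define P where "P = Abs_fps (\<lambda>n. Dyck_sum m n x)"
  have "fps_XD P $ n = (P * bridge_fps m x) $ n" for n
  proof -
    have "(P * bridge_fps m x) $ n = (bridge_fps m x * P) $ n" by (simp add: mult.commute)
    also have "\<dots> = (\<Sum>i=0..n. bridge_fps m x $ i * Dyck_sum m (n - i) x)"
      by (simp add: fps_mult_nth P_def)
    also have "\<dots> = (\<Sum>i=1..n. bridge_sum m i x * Dyck_sum m (n - i) x)"
      by (intro sum.mono_neutral_cong_right) (auto simp: bridge_fps_def)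
    also have "\<dots> = of_nat n * Dyck_sum m n x"
      by (rule of_nat_times_Dyck_sum[OF assms, symmetric])
    finally show ?thesis by (simp add: P_def)
  qed
  then have "log_deriv P = bridge_fps m x"
    using assms by (subst log_deriv_eq_iff) (auto simp: fps_eq_iff P_def Dyck_sum_0)
  then show ?thesis by (simp add: P_def)
qed

section \<open>Powers of \<open>q\<close> and the \<open>q\<close>-difference equation of
  \<open>H\<close>\<close>

lemma embed_poly_simps [simp]:
  "embed_poly 0 = 0" "embed_poly 1 = 1"
  "embed_poly (p + r) = embed_poly p + embed_poly r"
  "embed_poly (p * r) = embed_poly p * embed_poly r"
  by (simp_all add: embed_poly_def Zero_fract_def One_fract_def)

lemma embed_poly_eq_iff [simp]: "embed_poly p = embed_poly r \<longleftrightarrow> p = r"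
  by (simp add: embed_poly_def eq_fract)

lemma qvar_power: "qvar ^ k = embed_poly (monom 1 k)"
  by (induction k) (simp_all add: qvar_def mult_monom flip: embed_poly_simps(4))

lemma qvar_nonzero [simp]: "qvar \<noteq> 0"
  by (metis qvar_def embed_poly_simps(1) embed_poly_eq_iff monom_eq_0_iff one_neq_zero)

lemma qvar_power_eq_1_iff [simp]: "qvar ^ k = 1 \<longleftrightarrow> k = 0"
proof -
  have "monom 1 k = (1 :: rat poly) \<longleftrightarrow> k = 0"
    by (metis degree_1 degree_monom_eq monom_0 one_neq_zero one_pCons pCons_one)
  then show ?thesis unfolding qvar_power by (metis embed_poly_eq_iff embed_poly_simps(2))
qed

lemma H_series_0: "H_series m $ 0 = 1"
  by (simp add: H_series_def)

lemma H_series_rec: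
  "H_series m $ Suc n * (1 - inverse qvar ^ Suc n) = qvar ^ ((m - 1) * n) * H_series m $ n"
proof -
  have *: "inverse qvar ^ Suc n \<noteq> 1"
    using qvar_power_eq_1_iff[of "Suc n"] by (simp add: power_inverse del: power_Suc qvar_power_eq_1_iff)
  have "Suc n choose 2 = n + (n choose 2)" by (simp add: numeral_2_eq_2)
  then have "H_series m $ Suc n = qvar ^ ((m - 1) * n) * H_series m $ n / (1 - inverse qvar ^ Suc n)"
    by (simp add: H_series_def power_int_minus power_inverse distrib_left power_add
        divide_inverse mult_ac del: power_Suc)
  then show ?thesis using * by (simp del: power_Suc)
qed

text \<open>The second identity, \<open>H(t) = H(t/q) + t H(q^(m-1) t)\<close>, is the coefficient
  recursion of \<open>H\<close> in closed form. The first is the second with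
  \<open>q^(s+1) t\<close> in place of \<open>t\<close>.\<close>

lemma dilate_H_series:
  "dilate (qvar ^ Suc s) (H_series m) = dilate (qvar ^ s) (H_series m)
     + fps_const (qvar ^ Suc s) * (fps_X * dilate (qvar ^ (Suc s + (m - 1))) (H_series m))"
  "H_series m = dilate (inverse qvar) (H_series m) + fps_X * dilate (qvar ^ (m - 1)) (H_series m)"
proof -
  show 2: "H_series m = dilate (inverse qvar) (H_series m) + fps_X * dilate (qvar ^ (m - 1)) (H_series m)"
  proof (rule fps_ext)
    fix n
    show "H_series m $ n = (dilate (inverse qvar) (H_series m) + fps_X * dilate (qvar ^ (m - 1)) (H_series m)) $ n"
    proof (cases n)
      case (Suc k)
      have "H_series m $ Suc k = H_series m $ Suc k * (1 - inverse qvar ^ Suc k)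
          + inverse qvar ^ Suc k * H_series m $ Suc k"
        by (simp add: algebra_simps)
      then show ?thesis unfolding H_series_rec Suc
        by (simp add: power_mult del: power_Suc)
    qed simp
  qed
  have "dilate (qvar ^ Suc s) (H_series m)
      = dilate (qvar ^ Suc s) (dilate (inverse qvar) (H_series m) + fps_X * dilate (qvar ^ (m - 1)) (H_series m))"
    using 2 by simp
  also have "\<dots> = dilate (qvar ^ s) (H_series m)
     + fps_const (qvar ^ Suc s) * (fps_X * dilate (qvar ^ (Suc s + (m - 1))) (H_series m))"
  proof (rule fps_ext)
    fix n
    have "qvar ^ Suc s * inverse qvar = qvar ^ s" by simp
    then have a: "(qvar ^ Suc s) ^ n * inverse qvar ^ n = (qvar ^ s) ^ n"
      by (metis power_mult_distrib)
    show "dilate (qvar ^ Suc s) (dilate (inverse qvar) (H_series m) + fps_X * dilate (qvar ^ (m - 1)) (H_series m)) $ n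
       = (dilate (qvar ^ s) (H_series m)
          + fps_const (qvar ^ Suc s) * (fps_X * dilate (qvar ^ (Suc s + (m - 1))) (H_series m))) $ n"
    proof (cases n)
      case (Suc k)
      have b: "(qvar ^ Suc s) ^ Suc k * (qvar ^ (m - 1)) ^ k
          = qvar ^ Suc s * (qvar ^ (Suc s + (m - 1))) ^ k"
        by (simp add: power_add power_mult_distrib mult_ac)
      show ?thesis
        using a unfolding Suc
        by (simp add: distrib_left del: power_Suc One_nat_def add_Suc)
           (simp add: mult.assoc[symmetric] b del: power_Suc One_nat_def add_Suc)
    qed simp
  qed
  finally show "dilate (qvar ^ Suc s) (H_series m) = dilate (qvar ^ s) (H_series m)
     + fps_const (qvar ^ Suc s) * (fps_X * dilate (qvar ^ (Suc s + (m - 1))) (H_series m))" .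
qed

text \<open>Dividing both dilation identities by \<open>H(t/q)\<close> shows that the quotients
  \<open>V s\<close> solve the difference equation that characterizes Dyck sums: the second identity
  gives \<open>s = 0\<close>, the first the step to \<open>Suc s\<close>.\<close>

lemma H_series_eq_Dyck:
  assumes "m \<ge> 1"
  shows "H_series m = Abs_fps (\<lambda>n. Dyck_sum m n qvar) * dilate (inverse qvar) (H_series m)"
proof -
  define D where "D = dilate (inverse qvar) (H_series m)"
  define V where "V = (\<lambda>s. dilate (qvar ^ s) (H_series m) * inverse D)"
  have D: "D * inverse D = 1"
    by (rule inverse_mult_eq_1') (simp add: D_def H_series_0)
  have "V s = 1 + fps_X * (\<Sum>i\<le>s. fps_const (qvar ^ i) * V (i + (m - 1)))" for s
  proof (induction s)
    case 0
    have "V 0 = H_series m * inverse D" by (simp add: V_def)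
    also have "\<dots> = D * inverse D + fps_X * V (m - 1)"
      by (subst dilate_H_series(2)) (simp add: D_def V_def algebra_simps)
    finally show ?case by (simp add: D)
  next
    case (Suc s)
    have "V (Suc s) = V s + fps_const (qvar ^ Suc s) * (fps_X * V (Suc s + (m - 1)))"
      unfolding V_def by (subst dilate_H_series(1)) (simp add: algebra_simps)
    then show ?case by (simp add: Suc algebra_simps)
  qed
  then have "V 0 = Abs_fps (\<lambda>n. Dyck_sum m n qvar)" by (rule Dyck_sum_unique[OF assms])
  moreover have "V 0 * D = H_series m" using D by (simp add: V_def mult.assoc mult.commute)
  ultimately show ?thesis by (simp add: D_def)
qed

text \<open>Writing \<open>L\<close> for the logarithmic derivative, the factorization of
  \<open>H\<close> gives \<open>L_n = B_n + q^(-n) L_n\<close>, which is solved for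
  \<open>L_n\<close>.\<close>

lemma log_deriv_H_series:
  assumes "m \<ge> 1" "n > 0"
  shows "log_deriv (H_series m) $ n = bridge_sum m n qvar / (1 - inverse qvar ^ n)"
proof -
  have *: "inverse qvar ^ n \<noteq> 1"
    using qvar_power_eq_1_iff[of n] assms(2) by (simp add: power_inverse del: qvar_power_eq_1_iff)
  define P where "P = Abs_fps (\<lambda>n. Dyck_sum m n qvar)"
  have "log_deriv (H_series m) = log_deriv P + log_deriv (dilate (inverse qvar) (H_series m))"
    using Dyck_sum_0[OF assms(1), of qvar]
    by (subst H_series_eq_Dyck[OF assms(1)], subst log_deriv_mult) (simp_all add: P_def H_series_0)
  also have "log_deriv P = bridge_fps m qvar"
    unfolding P_def by (rule log_deriv_Dyck[OF assms(1)]) simp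
  finally have "log_deriv (H_series m) $ n = (bridge_fps m qvar + log_deriv (dilate (inverse qvar) (H_series m))) $ n"
    by (rule arg_cong)
  also have "\<dots> = bridge_sum m n qvar + inverse qvar ^ n * log_deriv (H_series m) $ n"
    using assms(2) by (simp add: log_deriv_dilate H_series_0 bridge_fps_def)
  finally have "log_deriv (H_series m) $ n = bridge_sum m n qvar + inverse qvar ^ n * log_deriv (H_series m) $ n" .
  then have "log_deriv (H_series m) $ n * (1 - inverse qvar ^ n) = bridge_sum m n qvar"
    by (simp add: algebra_simps)
  then show ?thesis using * by (simp add: eq_divide_eq)
qed

section \<open>The series \<open>F\<close> and its logarithmic derivative\<close>

lemma fps_power_nth_cong:
  fixes F G :: "'a::comm_ring_1 fps"
  assumes "\<And>k. k < n \<Longrightarrow> F $ k = G $ k" "k < n"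
  shows "(F ^ m) $ k = (G ^ m) $ k"
  using assms(2)
proof (induction m arbitrary: k)
  case (Suc m)
  then show ?case by (simp add: fps_mult_nth assms(1))
qed simp

text \<open>The factor \<open>t\<close> makes the right-hand side a \<open>t\<close>-adic
  contraction. Iterating from 0, the coefficient at \<open>k\<close> is stable after
  \<open>k + 1\<close> steps; the same argument on coefficients gives uniqueness, which makes
  \<open>F_series\<close> well defined.\<close>

lemma Fuss_Catalan_ex1: "\<exists>!F :: 'a::comm_ring_1 fps. F = 1 + fps_X * F ^ m"
proof (rule ex_ex1I)
  define f where "f = rec_nat (0 :: 'a fps) (\<lambda>_ F. 1 + fps_X * F ^ m)"
  have f: "f (Suc n) = 1 + fps_X * f n ^ m" for n by (simp add: f_def)
  have step: "f (Suc n) $ k = f n $ k" if "k < n" for n k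
    using that
  proof (induction n arbitrary: k)
    case (Suc n)
    show ?case
    proof (cases k)
      case (Suc j)
      then have "(f (Suc n) ^ m) $ j = (f n ^ m) $ j"
        using Suc.IH Suc.prems by (intro fps_power_nth_cong[of n]) auto
      then show ?thesis unfolding f[of n] f[of "Suc n"] Suc by simp
    qed (simp add: f)
  qed simp
  define F where "F = Abs_fps (\<lambda>n. f (Suc n) $ n)"
  have F: "F $ k = f n $ k" if "k < n" for n k
  proof -
    have "f (Suc k + j) $ k = f (Suc k) $ k" for j
      by (induction j) (auto simp: step)
    from this[of "n - Suc k"] that show ?thesis by (simp add: F_def)
  qed
  have "F $ k = (1 + fps_X * F ^ m) $ k" for k
  proof (cases k)
    case (Suc j)
    have "(F ^ m) $ j = (f (Suc j) ^ m) $ j"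
      by (rule fps_power_nth_cong[of "Suc j"]) (auto simp: F)
    moreover have "F $ k = f (Suc (Suc j)) $ k" using Suc by (intro F) simp
    ultimately show ?thesis using Suc f[of "Suc j"] by simp
  qed (simp add: F_def f)
  then show "\<exists>F :: 'a fps. F = 1 + fps_X * F ^ m" by (metis fps_ext)
next
  fix F G :: "'a fps"
  assume F: "F = 1 + fps_X * F ^ m" and G: "G = 1 + fps_X * G ^ m"
  have "\<forall>k<n. F $ k = G $ k" for n
  proof (induction n)
    case (Suc n)
    have "F $ n = G $ n"
    proof (cases n)
      case 0
      then show ?thesis by (subst F, subst G) simp
    next
      case n: (Suc j)
      have "(F ^ m) $ j = (G ^ m) $ j"
        using Suc n by (intro fps_power_nth_cong[of n]) auto
      then show ?thesis using n by (subst F, subst G) simp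
    qed
    then show ?case using Suc by (auto simp: less_Suc_eq)
  qed simp
  then show "F = G" by (intro fps_ext) (metis lessI)
qed

definition F_rat :: "nat \<Rightarrow> rat fps" where
  "F_rat m = Abs_fps (\<lambda>k. of_int (F_series m $ k))"

lemma F_rat_eq: "F_rat m = 1 + fps_X * F_rat m ^ m"
proof -
  define h where "h = (\<lambda>F. Abs_fps (\<lambda>k. rat_of_int (F $ k)))"
  have "h (F * G) = h F * h G" for F G
    by (auto simp: h_def fps_eq_iff fps_mult_nth)
  moreover have "h 1 = 1" "h fps_X = fps_X" "h (F + G) = h F + h G" for F G
    by (auto simp: h_def fps_eq_iff)
  moreover have "h (F ^ k) = h F ^ k" for F k
    using calculation by (induction k) auto
  moreover have "F_series m = 1 + fps_X * F_series m ^ m"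
    unfolding F_series_def by (rule theI'[OF Fuss_Catalan_ex1])
  ultimately have "h (F_series m) = 1 + fps_X * h (F_series m) ^ m" by metis
  then show ?thesis by (simp add: h_def F_rat_def)
qed

lemma F_rat_0: "F_rat m $ 0 = 1"
  by (subst F_rat_eq) simp

lemma log_deriv_F_rat:
  assumes "m \<ge> 1"
  shows "log_deriv (F_rat m) = bridge_fps m 1"
proof -
  define F where "F = F_rat m"
  have F: "F = 1 + fps_X * F ^ m" unfolding F_def by (rule F_rat_eq)
  \<comment> \<open>The exponent is shifted by one so that \<open>s = 0\<close> is the defining
    equation of \<open>F\<close>, since \<open>Suc (m - 1) = m\<close>; the sums telescope by
    \<open>F ^ (s + 2) - F ^ (s + 1) = t F ^ (s + 1 + m)\<close>.\<close>
  have "F ^ Suc s = 1 + fps_X * (\<Sum>i\<le>s. fps_const (1 ^ i) * F ^ Suc (i + (m - 1)))" for s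
  proof (induction s)
    case 0
    then show ?case using F assms by simp
  next
    case (Suc s)
    have "F ^ Suc (Suc s) = F ^ Suc s * (1 + fps_X * F ^ m)" using F by (simp add: mult.commute)
    also have "\<dots> = F ^ Suc s + fps_X * F ^ (Suc s + m)" by (simp add: algebra_simps power_add)
    also have "Suc s + m = Suc (Suc s + (m - 1))" using assms by simp
    finally show ?case by (simp add: Suc algebra_simps del: power_Suc)
  qed
  then have "F ^ Suc 0 = Abs_fps (\<lambda>n. Dyck_sum m n 1)" by (rule Dyck_sum_unique[OF assms])
  then show ?thesis using log_deriv_Dyck[OF assms, of "1::rat"] by (simp add: F_def)
qed

section \<open>The quantized invariants\<close>

lemma pcompose_monom_nonzero:
  "i > 0 \<Longrightarrow> c \<noteq> 0 \<Longrightarrow> c \<circ>\<^sub>p monom 1 i \<noteq> (0 :: rat poly)"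
  using pcompose_eq_0[of c "monom 1 i"] by (auto simp: degree_monom_eq)

text \<open>Composition with \<open>q ^ i\<close> preserves the cross-multiplied equality of
  fractions and keeps denominators nonzero as \<open>i > 0\<close>, so the value does not depend on
  the chosen fraction.\<close>

lemma subst_qpow_Fract:
  assumes "i > 0" "b \<noteq> 0"
  shows "subst_qpow i (Fraction_Field.Fract a b)
    = Fraction_Field.Fract (a \<circ>\<^sub>p monom 1 i) (b \<circ>\<^sub>p monom 1 i)"
  unfolding subst_qpow_def
proof (rule the_equality)
  fix y
  assume "\<exists>a' b'. b' \<noteq> 0 \<and> Fraction_Field.Fract a b = Fraction_Field.Fract a' b' \<and>
    y = Fraction_Field.Fract (a' \<circ>\<^sub>p monom 1 i) (b' \<circ>\<^sub>p monom 1 i)"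
  then obtain a' b' where *: "b' \<noteq> 0" "Fraction_Field.Fract a b = Fraction_Field.Fract a' b'"
    "y = Fraction_Field.Fract (a' \<circ>\<^sub>p monom 1 i) (b' \<circ>\<^sub>p monom 1 i)" by blast
  then have "a * b' = a' * b" using assms by (simp add: eq_fract)
  then have "(a \<circ>\<^sub>p monom 1 i) * (b' \<circ>\<^sub>p monom 1 i) = (a' \<circ>\<^sub>p monom 1 i) * (b \<circ>\<^sub>p monom 1 i)"
    by (metis pcompose_mult)
  then show "y = Fraction_Field.Fract (a \<circ>\<^sub>p monom 1 i) (b \<circ>\<^sub>p monom 1 i)"
    using * assms pcompose_monom_nonzero by (simp add: eq_fract)
qed (use assms in blast)

context
  fixes i :: nat
  assumes i: "i > 0"
begin

lemma subst_qpow_add: "subst_qpow i (x + y) = subst_qpow i x + subst_qpow i y"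
  by (cases x; cases y)
     (simp add: subst_qpow_Fract i pcompose_monom_nonzero pcompose_add pcompose_mult)

lemma subst_qpow_mult: "subst_qpow i (x * y) = subst_qpow i x * subst_qpow i y"
  by (cases x; cases y) (simp add: subst_qpow_Fract i pcompose_mult)

lemma subst_qpow_0: "subst_qpow i 0 = 0"
  by (simp add: Zero_fract_def subst_qpow_Fract i pcompose_1)

lemma subst_qpow_1: "subst_qpow i 1 = 1"
  by (simp add: One_fract_def subst_qpow_Fract i pcompose_1)

lemma subst_qpow_uminus: "subst_qpow i (- x) = - subst_qpow i x"
  using subst_qpow_add[of x "- x"] by (simp add: subst_qpow_0 add_eq_0_iff)

lemma subst_qpow_diff: "subst_qpow i (x - y) = subst_qpow i x - subst_qpow i y"
  using subst_qpow_add[of x "- y"] by (simp add: subst_qpow_uminus)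

lemma subst_qpow_inverse: "subst_qpow i (inverse x) = inverse (subst_qpow i x)"
proof (cases "x = 0")
  case False
  then have "subst_qpow i x * subst_qpow i (inverse x) = 1"
    by (simp add: subst_qpow_1 flip: subst_qpow_mult)
  then show ?thesis by (simp add: inverse_unique)
qed (simp add: subst_qpow_0)

lemma subst_qpow_divide: "subst_qpow i (x / y) = subst_qpow i x / subst_qpow i y"
  by (simp add: divide_inverse subst_qpow_mult subst_qpow_inverse)

lemma subst_qpow_power: "subst_qpow i (x ^ k) = subst_qpow i x ^ k"
  by (induction k) (simp_all add: subst_qpow_1 subst_qpow_mult)

lemma subst_qpow_power_int: "subst_qpow i (x powi k) = subst_qpow i x powi k"
  by (simp add: power_int_def subst_qpow_power subst_qpow_inverse)

lemma subst_qpow_sum: "subst_qpow i (sum f A) = (\<Sum>a\<in>A. subst_qpow i (f a))"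
  by (induction A rule: infinite_finite_induct) (simp_all add: subst_qpow_0 subst_qpow_add)

lemma subst_qpow_qvar: "subst_qpow i qvar = qvar ^ i"
proof -
  have "monom 1 1 \<circ>\<^sub>p monom 1 i = (monom 1 i :: rat poly)"
    by (simp add: monom_Suc pcompose_pCons monom_0)
  then show ?thesis
    using subst_qpow_Fract[OF i, of 1 "monom 1 1"] unfolding qvar_power
    unfolding qvar_def embed_poly_def by (simp add: pcompose_1)
qed

lemma subst_qpow_plus_sum: "subst_qpow i (plus_sum m n qvar) = plus_sum m n (qvar ^ i)"
  by (simp add: plus_sum_def subst_qpow_sum subst_qpow_power_int subst_qpow_qvar)

end

section \<open>Coefficients and injectivity of the plethystic exponential\<close>

lemma subst_qpow_by_1: "subst_qpow 1 x = x"
proof -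
  have "monom 1 1 = ([:0, 1:] :: rat poly)" by (simp add: monom_Suc monom_0)
  then show ?thesis by (cases x) (simp add: subst_qpow_Fract pcompose_idR)
qed

text \<open>Only the indices \<open>i\<close> dividing \<open>n\<close> contribute to coefficient
  \<open>n > 0\<close>, so the partial sums are constant there from \<open>N = n\<close> on.\<close>

lemma plethystic_exp_eq:
  assumes "f $ 0 = 0"
  shows "plethystic_exp f = fps_exp 1 oo
    Abs_fps (\<lambda>n. \<Sum>i | i dvd n. 1 / of_nat i * subst_qpow i (f $ (n div i)))"
    (is "_ = _ oo ?g")
proof -
  let ?t = "\<lambda>i. fps_const (1 / of_nat (Suc i)) * adams (Suc i) f"
  have "(\<lambda>N. \<Sum>i<N. ?t i) \<longlonglongrightarrow> ?g"
  proof (rule tendsto_fpsI)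
    fix n
    have "(\<Sum>i<N. ?t i) $ n = ?g $ n" if N: "N \<ge> n" for N
    \<comment> \<open>Every \<open>i\<close> divides 0, so at \<open>n = 0\<close> the sum in
      \<open>?g\<close> ranges over an infinite set and is 0 by convention; this is the right value
      because \<open>f $ 0 = 0\<close>.\<close>
    proof (cases "n = 0")
      case True
      then show ?thesis by (simp add: fps_sum_nth adams_def assms subst_qpow_0)
    next
      case False
      have "(\<Sum>i<N. ?t i) $ n = (\<Sum>i\<in>{i\<in>{..<N}. Suc i dvd n}. 1 / of_nat (Suc i) * subst_qpow (Suc i) (f $ (n div Suc i)))"
        by (subst sum.inter_filter, simp, simp only: fps_sum_nth, intro sum.cong)
           (auto simp: adams_def)
      also have "\<dots> = ?g $ n"
        unfolding fps_nth_Abs_fps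
      proof (rule sum.reindex_bij_witness[of _ "\<lambda>i. i - 1" Suc], goal_cases)
        case (3 i)
        then show ?case using False by (cases i) auto
      next
        case (4 i)
        then have "i > 0" "i \<le> n" using False by (auto intro: Nat.gr0I dvd_imp_le)
        then show ?case using 4 N by auto
      qed auto
      finally show ?thesis .
    qed
    then show "\<forall>\<^sub>F N in sequentially. (\<Sum>i<N. ?t i) $ n = ?g $ n"
      unfolding eventually_sequentially by blast
  qed
  then have "?t sums ?g" by (simp add: sums_def)
  then show ?thesis unfolding plethystic_exp_def by (simp only: sums_unique[symmetric])
qed

lemma plethystic_exp_0: "f $ 0 = 0 \<Longrightarrow> plethystic_exp f $ 0 = 1"
  by (simp add: plethystic_exp_eq)

text \<open>\<open>t d/dt\<close> multiplies coefficient \<open>n\<close> by \<open>n\<close>, which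
  turns the weight \<open>1 / i\<close> into the complementary divisor
  \<open>k = n div i\<close>.\<close>

lemma log_deriv_plethystic_exp:
  assumes "f $ 0 = 0" "n > 0"
  shows "log_deriv (plethystic_exp f) $ n = (\<Sum>k | k dvd n. of_nat k * subst_qpow (n div k) (f $ k))"
proof -
  have "log_deriv (plethystic_exp f) $ n = of_nat n * (\<Sum>i | i dvd n. 1 / of_nat i * subst_qpow i (f $ (n div i)))"
    unfolding plethystic_exp_eq[OF assms(1)] by (subst log_deriv_exp_compose) simp_all
  also have "\<dots> = (\<Sum>i | i dvd n. of_nat (n div i) * subst_qpow i (f $ (n div i)))"
    unfolding sum_distrib_left
  proof (intro sum.cong refl)
    fix i assume "i \<in> {i. i dvd n}"
    then obtain j where "n = i * j" "i > 0" using assms(2) by auto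
    then show "of_nat n * (1 / of_nat i * subst_qpow i (f $ (n div i)))
        = of_nat (n div i) * subst_qpow i (f $ (n div i))"
      by simp
  qed
  also have "\<dots> = (\<Sum>k | k dvd n. of_nat k * subst_qpow (n div k) (f $ k))"
    by (rule sum.reindex_bij_witness[of _ "\<lambda>k. n div k" "\<lambda>k. n div k"])
       (use assms(2) in \<open>auto elim!: dvdE\<close>)
  finally show ?thesis .
qed

text \<open>In the divisor sum for the logarithmic derivative, \<open>k = n\<close> contributes
  \<open>n\<close> times coefficient \<open>n\<close> itself, and all other terms involve smaller
  indices only. The coefficients are thus recovered one after another.\<close>

lemma plethystic_exp_inject:
  assumes "f $ 0 = 0" "g $ 0 = 0" "plethystic_exp f = plethystic_exp g"
  shows "f = g"
proof (rule fps_ext)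
  fix n
  show "f $ n = g $ n"
  proof (induction n rule: less_induct)
    case (less n)
    show ?case
    proof (cases "n = 0")
      case False
      then have fin: "finite {k. k dvd n}" by simp
      have "log_deriv (plethystic_exp h) $ n
          = of_nat n * h $ n + (\<Sum>k\<in>{k. k dvd n} - {n}. of_nat k * subst_qpow (n div k) (h $ k))"
        if "h $ 0 = 0" for h
        using False that fin
        by (subst log_deriv_plethystic_exp, simp, simp, subst sum.remove[of _ n]) (auto simp: subst_qpow_by_1[unfolded One_nat_def])
      note log_deriv = this[of f, OF assms(1)] this[of g, OF assms(2)]
      have "(\<Sum>k\<in>{k. k dvd n} - {n}. of_nat k * subst_qpow (n div k) (f $ k))
          = (\<Sum>k\<in>{k. k dvd n} - {n}. of_nat k * subst_qpow (n div k) (g $ k))"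
      proof (intro sum.cong refl)
        fix k assume "k \<in> {k. k dvd n} - {n}"
        then have "k < n" using False by (auto intro: le_neq_implies_less dvd_imp_le)
        then show "of_nat k * subst_qpow (n div k) (f $ k) = of_nat k * subst_qpow (n div k) (g $ k)"
          by (simp add: less.IH)
      qed
      with log_deriv have "of_nat n * f $ n = of_nat n * g $ n"
        unfolding assms(3) by auto
      then show ?thesis using False by simp
    qed (use assms in simp)
  qed
qed

lemma inverse_qvar_power_neq_1: "n > 0 \<Longrightarrow> 1 - inverse qvar ^ n \<noteq> 0"
  using qvar_power_eq_1_iff[of n] by (simp add: power_inverse del: qvar_power_eq_1_iff)

text \<open>The candidate \<open>D\<close> is checked on logarithmic derivatives. Substituting
  \<open>q ^ (N div k)\<close> turns every denominator \<open>1 - q^(-k)\<close> into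
  \<open>1 - q^(-N)\<close>, so the divisor sum reduces to \<open>signed_plus_sum\<close> and
  matches \<open>log_deriv_H_series\<close>. Injectivity of the plethystic exponential gives
  uniqueness.\<close>

lemma quantized_DT_eq_plus_sum:
  assumes "m \<ge> 1" "n > 0"
  shows "quantized_DT m n = (1 - inverse qvar) / (1 - inverse qvar ^ n) * plus_sum m n qvar"
proof -
  define e :: ratfun where "e = (-1) ^ (m - 1)"
  have e: "e \<noteq> 0" by (simp add: e_def)
  have sign: "sign_t m = fps_const e * fps_X" by (simp add: sign_t_def e_def)
  define c where "c = 1 / (1 - qvar powi (-1))"
  have c: "c = 1 / (1 - inverse qvar)" by (simp add: c_def power_int_minus)
  have c0: "c \<noteq> 0" using inverse_qvar_power_neq_1[of 1] by (simp add: c)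
  define D where "D = Abs_fps (\<lambda>n. if n = 0 then 0 else
    (1 - inverse qvar) / (1 - inverse qvar ^ n) * plus_sum m n qvar)"
  define f where "f = fps_const c * (D oo sign_t m)"
  have f0: "f $ 0 = 0" by (simp add: f_def sign D_def)
  have f: "f $ k = e ^ k * (plus_sum m k qvar / (1 - inverse qvar ^ k))" if "k > 0" for k
    using that c0 by (simp add: f_def sign D_def c)
  have "H_series m oo sign_t m = plethystic_exp f"
  proof (rule log_deriv_inject)
    show "log_deriv (H_series m oo sign_t m) = log_deriv (plethystic_exp f)"
    proof (rule fps_ext)
      fix N
      show "log_deriv (H_series m oo sign_t m) $ N = log_deriv (plethystic_exp f) $ N"
      proof (cases "N = 0")
        case False
        have "log_deriv (plethystic_exp f) $ N = (\<Sum>k | k dvd N. of_nat k * subst_qpow (N div k) (f $ k))"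
          using False f0 by (simp add: log_deriv_plethystic_exp)
        also have "\<dots> = (\<Sum>k | k dvd N.
            e ^ k * (of_nat k * plus_sum m k (qvar ^ (N div k))) / (1 - inverse qvar ^ N))"
        proof (intro sum.cong refl)
          fix k assume "k \<in> {k. k dvd N}"
          then have k: "k > 0" "N div k > 0" "N div k * k = N" using False by (auto elim!: dvdE)
          \<comment> \<open>Signs are rational constants and stay fixed, so term \<open>k\<close>
            keeps the sign \<open>e ^ k\<close>, as \<open>signed_plus_sum\<close> requires.\<close>
          have "subst_qpow (N div k) (e ^ k) = e ^ k"
            by (simp add: e_def subst_qpow_power subst_qpow_uminus subst_qpow_1 k)
          moreover have "subst_qpow (N div k) (inverse qvar ^ k) = inverse qvar ^ N"
            using k by (simp add: subst_qpow_power subst_qpow_inverse subst_qpow_qvar power_inverse flip: power_mult)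
          ultimately have "subst_qpow (N div k) (f $ k)
              = e ^ k * (plus_sum m k (qvar ^ (N div k)) / (1 - inverse qvar ^ N))"
            using k(2) unfolding f[OF k(1)]
            by (simp add: subst_qpow_mult subst_qpow_divide subst_qpow_diff subst_qpow_1 subst_qpow_plus_sum)
          then show "of_nat k * subst_qpow (N div k) (f $ k)
            = e ^ k * (of_nat k * plus_sum m k (qvar ^ (N div k))) / (1 - inverse qvar ^ N)" by simp
        qed
        also have "\<dots> = e ^ N * bridge_sum m N qvar / (1 - inverse qvar ^ N)"
          using signed_plus_sum[OF assms(1), of N qvar] False
          by (simp add: e_def flip: sum_divide_distrib)
        also have "\<dots> = log_deriv (H_series m oo sign_t m) $ N"
          using False assms(1) by (simp add: sign log_deriv_dilate H_series_0 log_deriv_H_series)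
        finally show ?thesis ..
      qed simp
    qed
  qed (simp_all add: sign H_series_0 plethystic_exp_0 f0)
  then have D: "D $ 0 = 0 \<and> H_series m oo sign_t m
      = plethystic_exp (fps_const (1 / (1 - qvar powi (-1))) * (D oo sign_t m))"
    by (simp add: f_def c_def D_def)
  have "quantized_DT_series m = D"
    unfolding quantized_DT_series_def
  proof (rule the_equality, rule D)
    fix D' :: "ratfun fps"
    assume D': "D' $ 0 = 0 \<and> H_series m oo sign_t m
      = plethystic_exp (fps_const (1 / (1 - qvar powi (-1))) * (D' oo sign_t m))"
    have "plethystic_exp (fps_const c * (D' oo sign_t m)) = plethystic_exp (fps_const c * (D oo sign_t m))"
      using D D' unfolding c_def by metis
    then have "fps_const c * (D' oo sign_t m) = fps_const c * (D oo sign_t m)"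
      by (rule plethystic_exp_inject[rotated 2]) (use D D' in \<open>simp_all add: sign\<close>)
    then have "\<forall>k. e ^ k * D' $ k = e ^ k * D $ k"
      using c0 by (simp add: sign fps_eq_iff)
    then show "D' = D" using e by (simp add: fps_eq_iff)
  qed
  then show ?thesis using assms(2) by (simp add: quantized_DT_def D_def)
qed

lemma qint_eq: "qint n * (qvar - 1) = qvar ^ n - 1"
  by (simp add: qint_def power_diff_1_eq mult.commute)

lemma qint_nonzero: "n > 0 \<Longrightarrow> qint n \<noteq> 0"
  using qint_eq[of n] by auto

lemma quantized_DT_formula:
  assumes "m \<ge> 1" "n > 0"
  shows "quantized_DT m n = qvar powi (int n - 1) * (1 / qint n) * plus_sum m n qvar"
proof -
  obtain k where k: "n = Suc k" using assms(2) by (cases n) auto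
  have "qvar ^ k * inverse qvar ^ k = 1" by (simp flip: power_mult_distrib)
  then have "qvar ^ k * (1 - inverse qvar ^ n) = qvar ^ k - inverse qvar"
    by (simp add: k right_diff_distrib mult.left_commute)
  also have "\<dots> = inverse qvar * (qvar ^ n - 1)"
    by (simp add: k right_diff_distrib mult.assoc[symmetric])
  also have "\<dots> = (1 - inverse qvar) * qint n"
    unfolding qint_eq[symmetric] by (simp add: left_diff_distrib right_diff_distrib mult.left_commute)
  finally have "qvar ^ k * (1 / qint n) = (1 - inverse qvar) / (1 - inverse qvar ^ n)"
    using qint_nonzero[OF assms(2)] inverse_qvar_power_neq_1[OF assms(2)]
    by (simp add: frac_eq_eq)
  then show ?thesis
    using quantized_DT_eq_plus_sum[OF assms] by (simp add: k)
qed

section \<open>The unquantized invariants\<close>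

text \<open>Convergence means that each coefficient is eventually equal to that of the limit. Up to
  index \<open>k\<close> this is equality of logarithmic derivatives, to which only the factors with
  \<open>n\<close> dividing the index contribute.\<close>

lemma DT_product_tendsto_iff:
  assumes "m \<ge> 1"
  shows "(\<lambda>N. \<Prod>n=1..N. one_minus_tpow n (- ((-1) ^ ((m - 1) * n) * of_nat n * d n)))
      \<longlonglongrightarrow> (F_rat m oo sign_t m)
    \<longleftrightarrow> (\<forall>k>0. (\<Sum>n | n dvd k. (-1) ^ ((m - 1) * n) * of_nat n * (of_nat n * d n))
          = (-1) ^ ((m - 1) * k) * bridge_sum m k 1)"
    (is "?P \<longlonglongrightarrow> ?G \<longleftrightarrow> (\<forall>k>0. ?L k = ?R k)")
proof -
  have sign: "sign_t m = fps_const ((-1) ^ (m - 1)) * fps_X" by (simp add: sign_t_def)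
  have P: "log_deriv (?P N) = (\<Sum>n=1..N. log_deriv (one_minus_tpow n (- ((-1) ^ ((m - 1) * n) * of_nat n * d n))))"
    and P0: "?P N $ 0 = 1" for N
    using log_deriv_prod[of "{1..N}" "\<lambda>n. one_minus_tpow n (- ((-1) ^ ((m - 1) * n) * of_nat n * d n))"]
    by simp_all
  have ldP: "log_deriv (?P N) $ k = ?L k" if "0 < k" "k \<le> N" for N k
  proof -
    have "log_deriv (?P N) $ k = (\<Sum>n=1..N. if n dvd k then (-1) ^ ((m - 1) * n) * of_nat n * (of_nat n * d n) else 0)"
      unfolding P fps_sum_nth using that
      by (intro sum.cong refl) (simp add: log_deriv_one_minus_tpow mult_ac)
    also have "\<dots> = ?L k"
      using that by (intro sum.mono_neutral_cong_right)
        (auto intro!: Nat.gr0I order_trans[OF dvd_imp_le] simp: Suc_le_eq)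
    finally show ?thesis .
  qed
  have G0: "?G $ 0 = 1" by (simp add: sign F_rat_0)
  have ldG: "log_deriv ?G $ k = ?R k" if "0 < k" for k
    using that assms by (simp add: sign log_deriv_dilate F_rat_0 log_deriv_F_rat bridge_fps_def power_mult)
  have eq: "(\<forall>j\<le>k. ?P N $ j = ?G $ j) \<longleftrightarrow> (\<forall>j. 0 < j \<and> j \<le> k \<longrightarrow> ?L j = ?R j)" if "k \<le> N" for N k
  proof -
    have "log_deriv (?P N) $ j = log_deriv ?G $ j \<longleftrightarrow> (0 < j \<longrightarrow> ?L j = ?R j)" if "j \<le> k" for j
      using ldP[of j N] ldG[of j] that \<open>k \<le> N\<close> by (cases "j = 0") simp_all
    then show ?thesis unfolding log_deriv_cong_upto[OF P0 G0, symmetric] by blast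
  qed
  show ?thesis
  proof
    assume lim: "?P \<longlonglongrightarrow> ?G"
    show "\<forall>k>0. ?L k = ?R k"
    proof (intro allI impI)
      fix k :: nat assume "k > 0"
      have "\<forall>\<^sub>F N in sequentially. \<forall>j\<in>{..k}. ?P N $ j = ?G $ j"
        using lim unfolding tendsto_fps_iff by (intro eventually_ball_finite) auto
      moreover have "\<forall>\<^sub>F N in sequentially. k \<le> N" by (rule eventually_ge_at_top)
      ultimately have "\<forall>\<^sub>F N in sequentially. (\<forall>j\<in>{..k}. ?P N $ j = ?G $ j) \<and> k \<le> N"
        by (rule eventually_conj)
      then obtain N where "\<forall>j\<in>{..k}. ?P N $ j = ?G $ j" "k \<le> N"
        by (auto simp: eventually_sequentially)
      then show "?L k = ?R k" using eq[of k N] \<open>k > 0\<close> by blast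
    qed
  next
    assume R: "\<forall>k>0. ?L k = ?R k"
    show "?P \<longlonglongrightarrow> ?G"
    proof (rule tendsto_fpsI)
      fix k
      have "?P N $ k = ?G $ k" if "k \<le> N" for N using eq[OF that] R by blast
      then show "\<forall>\<^sub>F N in sequentially. ?P N $ k = ?G $ k"
        unfolding eventually_sequentially by blast
    qed
  qed
qed

text \<open>The uniqueness half of Moebius inversion: by induction the terms at proper divisors
  agree, and \<open>k\<close> itself is left over.\<close>

lemma divisor_sum_inject:
  fixes g h :: "nat \<Rightarrow> 'a::ab_group_add"
  assumes "\<And>k. k > 0 \<Longrightarrow> (\<Sum>n | n dvd k. g n) = (\<Sum>n | n dvd k. h n)" "k > 0"
  shows "g k = h k"
  using assms(2)
proof (induction k rule: less_induct)
  case (less k)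
  have fin: "finite {n. n dvd k}" using less.prems by simp
  have *: "(\<Sum>n | n dvd k. f n) = f k + (\<Sum>n\<in>{n. n dvd k} - {k}. f n)" for f :: "nat \<Rightarrow> 'a"
    using fin by (subst sum.remove[of _ k]) auto
  have "(\<Sum>n\<in>{n. n dvd k} - {k}. g n) = (\<Sum>n\<in>{n. n dvd k} - {k}. h n)"
  proof (intro sum.cong refl)
    fix n assume "n \<in> {n. n dvd k} - {k}"
    then have "n > 0" "n < k" using less.prems
      by (auto intro!: Nat.gr0I intro: le_neq_implies_less dvd_imp_le)
    then show "g n = h n" by (rule less.IH[rotated])
  qed
  then show ?case using assms(1)[OF less.prems] unfolding *[of g] *[of h] by simp
qed

text \<open>At \<open>x = 1\<close>, \<open>signed_plus_sum\<close> is the divisor equation for the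
  exponents, with \<open>of_nat n * d n\<close> as the number of classes. Divisor sums determine
  their summands, so \<open>DT_seq\<close> is this solution.\<close>

lemma DT_eq:
  assumes "m \<ge> 1" "n > 0"
  shows "DT m n = of_nat (card (U_prim_plus_classes m n)) / of_nat n"
proof -
  define e where "e = (\<lambda>n. (-1) ^ ((m - 1) * n) :: rat)"
  define d where "d = (\<lambda>n. if n = 0 then 0 else plus_sum m n 1 / of_nat n :: rat)"
  define Q where "Q = (\<lambda>d. \<forall>k>0. (\<Sum>n | n dvd k. e n * of_nat n * (of_nat n * d n)) = e k * bridge_sum m k 1)"
  have "Q d"
    unfolding Q_def
  proof (intro allI impI)
    fix k :: nat assume k: "k > 0"
    have "(\<Sum>n | n dvd k. e n * of_nat n * (of_nat n * d n))
        = (\<Sum>n | n dvd k. ((-1) ^ (m - 1)) ^ n * (of_nat n * plus_sum m n (1 ^ (k div n))))"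
      by (intro sum.cong refl) (simp add: d_def e_def power_mult plus_sum_def)
    then show "(\<Sum>n | n dvd k. e n * of_nat n * (of_nat n * d n)) = e k * bridge_sum m k 1"
      unfolding signed_plus_sum[OF assms(1) k] by (simp add: e_def power_mult)
  qed
  have "DT_seq m = d"
    unfolding DT_seq_def F_rat_def[symmetric] DT_product_tendsto_iff[OF assms(1)]
  proof (rule the_equality)
    show "d 0 = 0 \<and> (\<forall>k>0. (\<Sum>n | n dvd k. (-1) ^ ((m - 1) * n) * of_nat n * (of_nat n * d n))
        = (-1) ^ ((m - 1) * k) * bridge_sum m k 1)"
      using \<open>Q d\<close> by (simp add: Q_def e_def) (simp add: d_def)
    fix d' :: "nat \<Rightarrow> rat"
    assume "d' 0 = 0 \<and> (\<forall>k>0. (\<Sum>n | n dvd k. (-1) ^ ((m - 1) * n) * of_nat n * (of_nat n * d' n))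
        = (-1) ^ ((m - 1) * k) * bridge_sum m k 1)"
    then have d': "d' 0 = 0 \<and> Q d'" by (simp add: Q_def e_def)
    show "d' = d"
    proof
      fix n show "d' n = d n"
      proof (cases "n = 0")
        case False
        have "e n * of_nat n * (of_nat n * d' n) = e n * of_nat n * (of_nat n * d n)"
        proof (rule divisor_sum_inject[where g = "\<lambda>n. e n * of_nat n * (of_nat n * d' n)"
              and h = "\<lambda>n. e n * of_nat n * (of_nat n * d n)"])
          fix k :: nat assume "k > 0"
          then show "(\<Sum>n | n dvd k. e n * of_nat n * (of_nat n * d' n))
              = (\<Sum>n | n dvd k. e n * of_nat n * (of_nat n * d n))"
            using \<open>Q d\<close> d' by (simp add: Q_def)
        qed (use False in simp)
        then show ?thesis using False by (simp add: e_def)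
      qed (use d' in \<open>simp add: d_def\<close>)
    qed
  qed
  then show ?thesis using assms(2) by (simp add: DT_def d_def plus_sum_1)
qed

lemma DT_eq_card:
  assumes "m \<ge> 1" "n > 0" "i < n"
  shows "DT m n = of_nat (card {C \<in> U_prim_plus_classes m n. [class_wt m C = int i] (mod int n)})"
proof -
  have "DT m n = of_nat (n * card {C \<in> U_prim_plus_classes m n. [class_wt m C = int i] (mod int n)}) / of_nat n"
    unfolding class_wt_equidistributed[OF assms] by (rule DT_eq[OF assms(1,2)])
  then show ?thesis using assms(2) by simp
qed

section \<open>Integrality of the quantized invariants\<close>

abbreviation embed_int_poly :: "int poly \<Rightarrow> ratfun" where
  "embed_int_poly p \<equiv> embed_poly (map_poly rat_of_int p)"

lemma embed_int_poly_simps [simp]: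
  "embed_int_poly (p + r) = embed_int_poly p + embed_int_poly r"
  "embed_int_poly (p * r) = embed_int_poly p * embed_int_poly r"
  "embed_int_poly (of_nat k) = of_nat k"
  "embed_int_poly (monom 1 k) = qvar ^ k"
proof -
  have add: "map_poly rat_of_int (p + r) = map_poly rat_of_int p + map_poly rat_of_int r" for p r
    by (simp add: poly_eq_iff coeff_map_poly)
  then show 1: "embed_int_poly (p + r) = embed_int_poly p + embed_int_poly r" for p r by simp
  show "embed_int_poly (p * r) = embed_int_poly p * embed_int_poly r"
    unfolding embed_poly_simps(4)[symmetric]
    by (intro arg_cong[where f = embed_poly]) (simp add: poly_eq_iff coeff_map_poly coeff_mult)
  show "embed_int_poly (of_nat k) = of_nat k"
    by (induction k) (simp_all add: 1)
  show "embed_int_poly (monom 1 k) = qvar ^ k"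
    by (simp add: map_poly_monom qvar_power)
qed

lemma embed_int_poly_diff_1: "embed_int_poly (p - 1) = embed_int_poly p - 1"
  using embed_int_poly_simps(1)[of "p - 1" 1] by (simp add: algebra_simps)

lemma embed_int_poly_sum: "embed_int_poly (sum f A) = (\<Sum>a\<in>A. embed_int_poly (f a))"
  by (induction A rule: infinite_finite_induct) simp_all

lemma class_wt_plus_nonneg:
  assumes "m \<ge> 1" "n > 0" "C \<in> U_prim_plus_classes m n"
  shows "class_wt m C \<ge> 0"
proof -
  have "U_prim_plus m n \<subseteq> U m n"
    by (auto simp: U_prim_plus_def U_prim_def U_dprim_def)
  then show ?thesis
    using assms class_wt_nonneg by (auto simp: U_prim_plus_classes_def)
qed

text \<open>Since \<open>q^(n k) - 1\<close> is a multiple of \<open>q^n - 1 = (q - 1) [n]\<close>,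
  each exponent may be reduced modulo \<open>n\<close> up to a multiple of \<open>[n]\<close>. By
  equidistribution the reduced sum is \<open>c (1 + q + ... + q^(n-1)) = c [n]\<close>.\<close>

lemma qint_dvd_plus_sum:
  assumes "m \<ge> 1" "n > 0"
  shows "\<exists>p. plus_sum m n qvar = qint n * embed_int_poly p"
proof -
  define Cs where "Cs = U_prim_plus_classes m n"
  define w where "w = (\<lambda>C. nat (class_wt m C))"
  define c where "c = card {C \<in> Cs. [class_wt m C = int 0] (mod int n)}"
  \<comment> \<open>\<open>T k\<close> is the cofactor \<open>1 + q^n + ... + q^(n (k - 1))\<close>
    of \<open>q^n - 1\<close> in \<open>q^(n k) - 1\<close>.\<close>
  define T where "T = (\<lambda>k. \<Sum>j<k. monom 1 (n * j) :: int poly)"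
  have w: "class_wt m C = int (w C)" if "C \<in> Cs" for C
    using that class_wt_plus_nonneg[OF assms] by (simp add: w_def Cs_def)
  have c: "card {C \<in> Cs. w C mod n = i} = c" if "i < n" for i
  proof -
    have "{C \<in> Cs. w C mod n = i} = {C \<in> Cs. [class_wt m C = int i] (mod int n)}"
      using that w by (auto simp: cong_int_iff) (auto simp: cong_def)
    moreover have "n * card {C \<in> Cs. [class_wt m C = int i] (mod int n)} = n * c"
      using class_wt_equidistributed[OF assms that] class_wt_equidistributed[OF assms assms(2)]
      by (simp add: c_def Cs_def)
    ultimately show ?thesis using assms(2) by simp
  qed
  have T: "embed_int_poly (T k) * (qvar - 1) * qint n = qvar ^ (n * k) - 1" for k
  proof -
    have "embed_int_poly (T k) = (\<Sum>j<k. (qvar ^ n) ^ j)"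
      by (simp add: T_def embed_int_poly_sum power_mult)
    then show ?thesis
      unfolding power_mult power_diff_1_eq[of "qvar ^ n" k] qint_eq[symmetric] by (simp add: mult_ac)
  qed
  have step: "qvar powi class_wt m C = qvar ^ (w C mod n)
      + qint n * embed_int_poly (monom 1 (w C mod n) * (monom 1 1 - 1) * T (w C div n))"
    if "C \<in> Cs" for C
  proof -
    have "qvar powi class_wt m C = qvar ^ (w C mod n + n * (w C div n))" using w[OF that] by simp
    also have "\<dots> = qvar ^ (w C mod n) + qvar ^ (w C mod n) * (qvar ^ (n * (w C div n)) - 1)"
      by (simp only: power_add) (simp add: algebra_simps)
    also have "\<dots> = qvar ^ (w C mod n)
      + qint n * embed_int_poly (monom 1 (w C mod n) * (monom 1 1 - 1) * T (w C div n))"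
      by (simp only: T[symmetric] embed_int_poly_simps embed_int_poly_diff_1 power_one_right mult_ac)
    finally show ?thesis .
  qed
  have "(\<Sum>C\<in>Cs. qvar ^ (w C mod n)) = (\<Sum>i<n. \<Sum>C\<in>{C\<in>Cs. w C mod n = i}. qvar ^ (w C mod n))"
    by (intro sum.group[symmetric]) (use assms in \<open>auto simp: Cs_def\<close>)
  also have "\<dots> = (\<Sum>i<n. of_nat c * qvar ^ i)"
    by (intro sum.cong refl) (simp add: c flip: sum_distrib_right)
  finally have "(\<Sum>C\<in>Cs. qvar ^ (w C mod n)) = qint n * of_nat c"
    by (simp add: qint_def sum_distrib_left mult.commute)
  moreover have "plus_sum m n qvar = (\<Sum>C\<in>Cs. qvar ^ (w C mod n)
      + qint n * embed_int_poly (monom 1 (w C mod n) * (monom 1 1 - 1) * T (w C div n)))"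
    unfolding plus_sum_def Cs_def[symmetric] by (intro sum.cong refl step)
  ultimately have "plus_sum m n qvar = qint n * embed_int_poly
      (of_nat c + (\<Sum>C\<in>Cs. monom 1 (w C mod n) * (monom 1 1 - 1) * T (w C div n)))"
    by (simp add: sum.distrib embed_int_poly_sum distrib_left flip: sum_distrib_left
        del: embed_int_poly_simps(2))
  then show ?thesis by blast
qed

theorem theorem6p8:
  fixes m n :: nat
  assumes "m \<ge> 1" and "n \<ge> 1"
  shows "(quantized_DT m n
            = qvar powi (int n - 1) * (1 / qint n)
                * (\<Sum>C\<in>U_prim_plus_classes m n. qvar powi (class_wt m C))
          \<and> (\<exists>p :: int poly. quantized_DT m n = embed_poly (map_poly rat_of_int p)))
       \<and> (\<forall>i\<in>{0..<n}. DT m n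
            = of_nat (card {C \<in> U_prim_plus_classes m n. [class_wt m C = int i] (mod int n)}))"
proof (intro conjI ballI)
  have n: "n > 0" using assms(2) by simp
  show formula: "quantized_DT m n = qvar powi (int n - 1) * (1 / qint n)
      * (\<Sum>C\<in>U_prim_plus_classes m n. qvar powi (class_wt m C))"
    using quantized_DT_formula[OF assms(1) n] by (simp add: plus_sum_def)
  obtain p where p: "plus_sum m n qvar = qint n * embed_int_poly p"
    using qint_dvd_plus_sum[OF assms(1) n] by blast
  have "int n - 1 = int (n - 1)" using n by simp
  then have "qvar powi (int n - 1) = qvar ^ (n - 1)" by (metis power_int_of_nat)
  then have "quantized_DT m n = embed_int_poly (monom 1 (n - 1) * p)"
    using quantized_DT_formula[OF assms(1) n] p qint_nonzero[OF n] by simp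
  then show "\<exists>p. quantized_DT m n = embed_int_poly p" by blast
  fix i assume "i \<in> {0..<n}"
  then show "DT m n = of_nat (card {C \<in> U_prim_plus_classes m n. [class_wt m C = int i] (mod int n)})"
    using DT_eq_card[OF assms(1) n] by simp
qed

end
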